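(* Let $\theta_B\approx 2.35526$ be the unique real root of $x^7-2x^6-x^4-x^3-2x^2-2x-1$. For every $\varepsilon>0$ there exist real numbers $\delta_1,\delta_2$ with $0<\delta_1<\delta_2<\varepsilon$ such that every real number $\gamma\in[\theta_B+\delta_1,\theta_B+\delta_2]$ is the growth rate of some permutation class.
   Context: A permutation of length $n$ is a sequence containing each element of $\{1,\dots,n\}$ exactly once. A permutation $\tau$ of length $k$ is a subpermutation of $\sigma$ if $\sigma$ has a subsequence of length $k$ whose terms are in the same relative order as those of $\tau$. A permutation class is a set of permutations closed downward under the subpermutation order. For a class $\mathcal{C}$, $\mathcal{C}_n$ denotes its members of length $n$, and "$\gamma$ is the growth rate of $\mathcal{C}$" means that $\lim_{n\to\infty}|\mathcal{C}_n|^{1/n}$ exists and equals $\gamma$. *)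

theory Defs
  imports Complex_Main
begin

definition is_perm :: "nat list \<Rightarrow> bool" where
  "is_perm p \<longleftrightarrow> distinct p \<and> set p = {1..length p}"

definition subperm :: "nat list \<Rightarrow> nat list \<Rightarrow> bool" where
  "subperm \<tau> \<sigma> \<longleftrightarrow>
     (\<exists>f :: nat \<Rightarrow> nat. strict_mono_on {..<length \<tau>} f \<and>
        (\<forall>i<length \<tau>. f i < length \<sigma>) \<and>
        (\<forall>i<length \<tau>. \<forall>j<length \<tau>. \<tau> ! i < \<tau> ! j \<longleftrightarrow> \<sigma> ! f i < \<sigma> ! f j))"

definition perm_class :: "nat list set \<Rightarrow> bool" where
  "perm_class C \<longleftrightarrow> (\<forall>\<sigma>\<in>C. is_perm \<sigma>) \<and>
     (\<forall>\<sigma>\<in>C. \<forall>\<tau>. is_perm \<tau> \<and> subperm \<tau> \<sigma> \<longrightarrow> \<tau> \<in> C)"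

definition class_level :: "nat list set \<Rightarrow> nat \<Rightarrow> nat list set" where
  "class_level C n = {\<sigma>\<in>C. length \<sigma> = n}"

definition growth_rate :: "nat list set \<Rightarrow> real \<Rightarrow> bool" where
  "growth_rate C \<gamma> \<longleftrightarrow>
     ((\<lambda>n. real (card (class_level C n)) powr (1 / real n)) \<longlongrightarrow> \<gamma>) sequentially"

end

theory Submission
  imports Defs "HOL-Analysis.Infinite_Sum"
begin

text \<open>A sum closed class has growth rate \<open>\<gamma>\<close> as soon as the weights \<open>(1 / \<gamma>) ^ n\<close> of its
  indecomposables, \<open>n\<close> the length, add up to \<open>1\<close>. The indecomposables used here are permutations
  whose inversion graph is a caterpillar: a path that may carry one of three kinds of fork at each end.
  Those with a fork at one end at most number \<open>1, 1, 2, 3, 5, 7, 8, 8, 8, \<dots>\<close> by length and give the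
  growth rate \<open>\<theta>B\<close>. With forks at both ends, \<open>k\<close> steps apart, there are nine
  caterpillars, and they can be ordered such that each initial segment of the nine may be added to the
  class. Choosing an initial segment for every \<open>k \<ge> N\<close> amounts to choosing the digits of an
  expansion in base \<open>\<gamma>\<^sup>2\<close>; as \<open>\<gamma> < 5 / 2\<close>, the gaps between the digits
  are small enough for a greedy expansion to reach every number in an interval. Letting \<open>N\<close> grow
  moves the resulting intervals of growth rates to \<open>\<theta>B\<close>.\<close>

section \<open>Inversion codes\<close>

text \<open>The entry at index \<open>j\<close> of a code counts the earlier entries that are larger than the one
  at index \<open>j\<close>. In these terms a direct sum of permutations is a concatenation of codes.\<close>

definition insert_last :: "nat list \<Rightarrow> nat \<Rightarrow> nat list" where
  "insert_last p x =
     map (\<lambda>v. if v < Suc (length p) - x then v else Suc v) p @ [Suc (length p) - x]"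

definition perm_of_code :: "nat list \<Rightarrow> nat list" where
  "perm_of_code = foldl insert_last []"

definition valid_code :: "nat list \<Rightarrow> bool" where
  "valid_code c \<longleftrightarrow> (\<forall>j<length c. c ! j \<le> j)"

lemma valid_code_Nil [simp]: "valid_code []"
  by (simp add: valid_code_def)

lemma valid_code_append:
  "valid_code (c @ d) \<longleftrightarrow> valid_code c \<and> (\<forall>j<length d. d ! j \<le> length c + j)"
proof
  assume v: "valid_code (c @ d)"
  have "c ! j \<le> j" if "j < length c" for j
    using v that by (auto simp: valid_code_def nth_append dest: spec[of _ j])
  moreover have "d ! j \<le> length c + j" if "j < length d" for j
    using v that by (auto simp: valid_code_def nth_append dest: spec[of _ "length c + j"])
  ultimately show "valid_code c \<and> (\<forall>j<length d. d ! j \<le> length c + j)"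
    by (simp add: valid_code_def)
next
  assume v: "valid_code c \<and> (\<forall>j<length d. d ! j \<le> length c + j)"
  show "valid_code (c @ d)"
    unfolding valid_code_def
  proof (intro allI impI)
    fix j assume j: "j < length (c @ d)"
    show "(c @ d) ! j \<le> j"
    proof (cases "j < length c")
      case True
      then show ?thesis using v by (simp add: valid_code_def nth_append)
    next
      case False
      then have "j - length c < length d" using j by simp
      then have "d ! (j - length c) \<le> length c + (j - length c)"
        using v by blast
      then show ?thesis using False by (simp add: nth_append)
    qed
  qed
qed

lemma valid_code_snoc [simp]: "valid_code (c @ [x]) \<longleftrightarrow> valid_code c \<and> x \<le> length c"
  by (simp add: valid_code_append)

lemma valid_code_append_valid: "valid_code c \<Longrightarrow> valid_code d \<Longrightarrow> valid_code (c @ d)"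
  unfolding valid_code_append by (auto simp: valid_code_def intro: trans_le_add2)

lemma perm_of_code_Nil [simp]: "perm_of_code [] = []"
  and perm_of_code_snoc: "perm_of_code (c @ [x]) = insert_last (perm_of_code c) x"
  by (simp_all add: perm_of_code_def)

lemma length_perm_of_code [simp]: "length (perm_of_code c) = length c"
  by (induction c rule: rev_induct) (simp_all add: perm_of_code_snoc insert_last_def)

lemma is_permI:
  assumes "distinct p" "set p \<subseteq> {1..length p}"
  shows "is_perm p"
proof -
  have "set p = {1..length p}"
    by (rule card_subset_eq) (use assms in \<open>auto simp: distinct_card\<close>)
  with assms show ?thesis by (simp add: is_perm_def)
qed

lemma is_perm_insert_last:
  assumes p: "is_perm p" and x: "x \<le> length p"
  shows "is_perm (insert_last p x)"
proof (rule is_permI)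
  have "inj (\<lambda>v. if v < Suc (length p) - x then v else Suc v)"
    by (auto intro!: injI split: if_splits)
  then have "distinct (map (\<lambda>v. if v < Suc (length p) - x then v else Suc v) p)"
    using p by (auto simp: distinct_map is_perm_def intro: inj_on_subset)
  then show "distinct (insert_last p x)"
    by (auto simp: insert_last_def split: if_splits)
  show "set (insert_last p x) \<subseteq> {1..length (insert_last p x)}"
    using p x by (auto simp: insert_last_def is_perm_def)
qed

lemma is_perm_perm_of_code: "valid_code c \<Longrightarrow> is_perm (perm_of_code c)"
proof (induction c rule: rev_induct)
  case Nil
  then show ?case by (simp add: is_perm_def)
next
  case (snoc x c)
  then show ?case by (simp add: perm_of_code_snoc is_perm_insert_last)
qed

text \<open>The last entry of the permutation reveals the last code entry, and the relabelling of
  the earlier values is injective, so the rest follows by induction.\<close>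

lemma perm_of_code_inject:
  "valid_code c \<Longrightarrow> valid_code d \<Longrightarrow> perm_of_code c = perm_of_code d \<Longrightarrow> c = d"
proof (induction c arbitrary: d rule: rev_induct)
  case Nil
  then show ?case by (metis length_0_conv length_perm_of_code)
next
  case (snoc x c)
  have "length d = Suc (length c)"
    using snoc.prems(3) by (metis length_append_singleton length_perm_of_code)
  then obtain e y where d: "d = e @ [y]"
    by (metis append_butlast_last_id length_0_conv nat.distinct(1))
  with \<open>length d = Suc (length c)\<close> have len: "length e = length c" by simp
  have eq: "insert_last (perm_of_code c) x = insert_last (perm_of_code e) y"
    using snoc.prems(3) by (simp add: d perm_of_code_snoc)
  then have "Suc (length c) - x = Suc (length c) - y"
    by (simp add: insert_last_def len)
  \<comment> \<open>These bounds make the truncated subtraction reversible.\<close>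
  moreover have "x \<le> length c" "y \<le> length c" using snoc.prems(1,2) by (simp_all add: d len)
  ultimately have xy: "x = y" by linarith
  have "inj (\<lambda>v. if v < Suc (length c) - x then v else Suc v)"
    by (auto intro!: injI split: if_splits)
  then have "perm_of_code c = perm_of_code e"
    using eq by (simp add: insert_last_def len xy inj_map_eq_map)
  then show ?case using snoc d xy by auto
qed

text \<open>If \<open>r\<close> is the rank, counted from the top, of an entry of a permutation, then
  \<open>rank_after r s\<close> is its rank after the code has been continued by \<open>s\<close>, and
  \<open>lower_code r s\<close> is what \<open>s\<close> becomes when that entry is deleted.\<close>

fun rank_after :: "nat \<Rightarrow> nat list \<Rightarrow> nat" where
  "rank_after r [] = r"
| "rank_after r (y # ys) = rank_after (if r \<le> y then r else Suc r) ys"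

fun lower_code :: "nat \<Rightarrow> nat list \<Rightarrow> nat list" where
  "lower_code r [] = []"
| "lower_code r (y # ys) =
     (if r \<le> y then (y - 1) # lower_code r ys else y # lower_code (Suc r) ys)"

text \<open>On arrival an entry with \<open>c ! i\<close> larger predecessors has rank
  \<open>Suc (c ! i)\<close> from the top.\<close>

definition code_delete :: "nat \<Rightarrow> nat list \<Rightarrow> nat list" where
  "code_delete i c = take i c @ lower_code (Suc (c ! i)) (drop (Suc i) c)"

definition perm_delete :: "nat \<Rightarrow> nat list \<Rightarrow> nat list" where
  "perm_delete i p = map (\<lambda>v. if p ! i < v then v - 1 else v) (take i p @ drop (Suc i) p)"

section \<open>Deletion of an entry, in codes and in permutations\<close>

lemma rank_after_append: "rank_after r (s @ t) = rank_after (rank_after r s) t"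
  by (induction s arbitrary: r) auto

lemma rank_after_ge: "r \<le> rank_after r s"
  by (induction s arbitrary: r) (auto intro: le_trans Suc_leD split: if_splits)

lemma lower_code_append:
  "lower_code r (s @ t) = lower_code r s @ lower_code (rank_after r s) t"
  by (induction s arbitrary: r) auto

lemma length_lower_code [simp]: "length (lower_code r s) = length s"
  by (induction s arbitrary: r) auto

lemma length_code_delete: "i < length c \<Longrightarrow> length (code_delete i c) = length c - 1"
  by (auto simp: code_delete_def)

lemma lower_code_id: "(\<forall>j<length s. s ! j < r + j) \<Longrightarrow> lower_code r s = s"
proof (induction s arbitrary: r)
  case (Cons y s)
  have "y < r" using Cons.prems by force
  moreover have "\<forall>j<length s. s ! j < Suc r + j"
    using Cons.prems by force
  ultimately show ?case using Cons.IH[of "Suc r"] by simp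
qed simp

text \<open>A valid continuation is a direct summand: all its entries lie above the deleted one, so
  none of them loses an inversion.\<close>

lemma lower_code_valid: "valid_code s \<Longrightarrow> r > 0 \<Longrightarrow> lower_code r s = s"
  by (rule lower_code_id) (auto simp: valid_code_def)

lemma code_delete_append2: "code_delete (length c + i) (c @ d) = c @ code_delete i d"
  by (simp add: code_delete_def nth_append)

lemma code_delete_append1:
  "i < length c \<Longrightarrow> valid_code d \<Longrightarrow> code_delete i (c @ d) = code_delete i c @ d"
proof -
  assume i: "i < length c" and d: "valid_code d"
  have "0 < rank_after (Suc (c ! i)) (drop (Suc i) c)"
    using rank_after_ge by (rule less_le_trans[rotated]) simp
  with i d show ?thesis
    by (simp add: code_delete_def nth_append lower_code_append lower_code_valid)
qed

text \<open>In a permutation of length \<open>n\<close> the value \<open>v\<close> has rank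
  \<open>n + 1 - v\<close> from the top.\<close>

lemma perm_of_code_nth:
  "valid_code c \<Longrightarrow> i < length c \<Longrightarrow>
     perm_of_code c ! i + rank_after (Suc (c ! i)) (drop (Suc i) c) = Suc (length c)"
proof (induction c rule: rev_induct)
  case (snoc x c)
  show ?case
  proof (cases "i = length c")
    case True
    then show ?thesis using snoc.prems
      by (simp add: perm_of_code_snoc insert_last_def nth_append)
  next
    case False
    then have i: "i < length c" using snoc.prems by simp
    with snoc show ?thesis
      by (auto simp: perm_of_code_snoc insert_last_def nth_append rank_after_append)
  qed
qed simp

text \<open>Induction on the code: appending a last entry commutes with deleting an earlier one,
  provided that the last code entry drops by one when the deleted entry was larger.\<close>

lemma perm_delete_perm_of_code:
  "valid_code c \<Longrightarrow> i < length c \<Longrightarrow>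
     perm_delete i (perm_of_code c) = perm_of_code (code_delete i c)"
proof (induction c rule: rev_induct)
  case (snoc x c)
  define p where "p = perm_of_code c"
  have p: "length p = length c" by (simp add: p_def)
  show ?case
  proof (cases "i = length c")
    case True
    have "map (\<lambda>v. if Suc (length p) - x < v then v - 1 else v)
            (map (\<lambda>v. if v < Suc (length p) - x then v else Suc v) p) = p"
      by (auto simp: map_idI)
    then show ?thesis using True
      by (simp add: perm_delete_def perm_of_code_snoc insert_last_def code_delete_def nth_append
          flip: p_def p)
  next
    case False
    then have i: "i < length c" using snoc.prems by simp
    define r where "r = rank_after (Suc (c ! i)) (drop (Suc i) c)"
    have r: "p ! i + r = Suc (length c)"
      using perm_of_code_nth[of c i] snoc.prems i by (simp add: p_def r_def)
    have r1: "r \<ge> 1"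
      unfolding r_def using rank_after_ge by (rule order_trans[rotated]) simp
    have x: "x \<le> length c" using snoc.prems by simp
    define y where "y = (if r \<le> x then x - 1 else x)"
    have del: "code_delete i (c @ [x]) = code_delete i c @ [y]"
      using i by (simp add: code_delete_def nth_append lower_code_append r_def y_def)
    have IH: "perm_of_code (code_delete i c) = perm_delete i p"
      using snoc i by (simp add: p_def)
    have len: "length (perm_delete i p) = length c - 1"
      using i by (simp add: perm_delete_def p)
    \<comment> \<open>\<open>b\<close> and \<open>b'\<close> relabel for the appended entry, before
      and after the deletion; \<open>d\<close> and \<open>d'\<close> relabel for the deletion,
      before and after appending.\<close>
    define b where "b = (\<lambda>v. if v < Suc (length p) - x then v else Suc v)"
    define b' where "b' = (\<lambda>v. if v < Suc (length c - 1) - y then v else Suc v)"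
    define d where "d = (\<lambda>v. if p ! i < v then v - 1 else v)"
    define d' where "d' = (\<lambda>v. if b (p ! i) < v then v - 1 else v)"
    have distinct: "distinct p" using snoc.prems is_perm_perm_of_code[of c]
      by (simp add: p_def is_perm_def)
    \<comment> \<open>The two orders of relabelling need not agree at the deleted value, so it must
      not recur among the remaining ones.\<close>
    have notin: "p ! i \<notin> set (take i p @ drop (Suc i) p)"
    proof -
      have "distinct (take i p @ p ! i # drop (Suc i) p)"
        using distinct i p by (metis id_take_nth_drop)
      then show ?thesis by simp
    qed
    have comm: "d' (b v) = b' (d v)" if "v \<noteq> p ! i" for v
      using that r r1 x i p by (auto simp: d_def d'_def b_def b'_def y_def)
    have "map d' (map b (take i p @ drop (Suc i) p)) = map b' (map d (take i p @ drop (Suc i) p))"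
    proof -
      have "\<forall>v\<in>set (take i p @ drop (Suc i) p). d' (b v) = b' (d v)"
      proof
        fix v assume "v \<in> set (take i p @ drop (Suc i) p)"
        then have "v \<noteq> p ! i" using notin by blast
        then show "d' (b v) = b' (d v)" by (rule comm)
      qed
      then show ?thesis by simp
    qed
    moreover have "d' (Suc (length p) - x) = Suc (length c - 1) - y"
      using r r1 x i p by (auto simp: d'_def b_def y_def)
    moreover have "perm_delete i (perm_of_code (c @ [x])) =
        map d' (map b (take i p @ drop (Suc i) p) @ [Suc (length p) - x])"
      using i p by (simp add: perm_delete_def perm_of_code_snoc insert_last_def nth_append
          p_def[symmetric] d'_def b_def take_map drop_map)
    moreover have "perm_of_code (code_delete i (c @ [x])) =
        map b' (map d (take i p @ drop (Suc i) p)) @ [Suc (length c - 1) - y]"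
      unfolding del perm_of_code_snoc IH insert_last_def len
      by (simp add: b'_def d_def perm_delete_def)
    ultimately show ?thesis by simp
  qed
qed simp

section \<open>Permutation classes from deletion-closed sets of codes\<close>

text \<open>An embedding of a shorter pattern misses some position, and the entry there can be
  deleted.\<close>

lemma subperm_perm_delete:
  assumes "subperm \<tau> \<sigma>" "length \<tau> < length \<sigma>" "distinct \<sigma>"
  shows "\<exists>i<length \<sigma>. subperm \<tau> (perm_delete i \<sigma>)"
proof -
  obtain f where f: "strict_mono_on {..<length \<tau>} f" "\<forall>i<length \<tau>. f i < length \<sigma>"
    "\<forall>i<length \<tau>. \<forall>j<length \<tau>. \<tau> ! i < \<tau> ! j \<longleftrightarrow> \<sigma> ! f i < \<sigma> ! f j"
    using assms(1) by (auto simp: subperm_def)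
  have "card (f ` {..<length \<tau>}) < card {..<length \<sigma>}"
    using card_image_le[of "{..<length \<tau>}" f] assms(2) by simp
  moreover have "f ` {..<length \<tau>} \<subseteq> {..<length \<sigma>}" using f(2) by auto
  ultimately obtain m where m: "m < length \<sigma>" "m \<notin> f ` {..<length \<tau>}"
    by (metis lessThan_iff less_irrefl psubsetI psubset_imp_ex_mem Diff_iff)
  define g where "g i = (if f i < m then f i else f i - 1)" for i
  define d where "d v = (if \<sigma> ! m < v then v - 1 else v)" for v
  have ne: "f i \<noteq> m" if "i < length \<tau>" for i using that m(2) by auto
  have nth: "perm_delete m \<sigma> ! g i = d (\<sigma> ! f i)" if "i < length \<tau>" for i
    using ne[OF that] that f(2) m(1)
    by (auto simp: perm_delete_def g_def d_def nth_append min_def)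
  have ne2: "\<sigma> ! f i \<noteq> \<sigma> ! m" if "i < length \<tau>" for i
    using ne[OF that] that f(2) m(1) assms(3) by (simp add: nth_eq_iff_index_eq)
  have "strict_mono_on {..<length \<tau>} g"
  proof (rule strict_mono_onI)
    fix i j assume ij: "i \<in> {..<length \<tau>}" "j \<in> {..<length \<tau>}" "i < j"
    then have "f i < f j" using strict_mono_onD[OF f(1)] by blast
    then show "g i < g j" using ij ne[of i] ne[of j] by (auto simp: g_def)
  qed
  moreover have "g i < length (perm_delete m \<sigma>)" if "i < length \<tau>" for i
    using ne[OF that] that f(2) m(1) by (auto simp: perm_delete_def g_def)
  moreover have "\<tau> ! i < \<tau> ! j \<longleftrightarrow> perm_delete m \<sigma> ! g i < perm_delete m \<sigma> ! g j"
    if ij: "i < length \<tau>" "j < length \<tau>" for i j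
  proof -
    have "\<tau> ! i < \<tau> ! j \<longleftrightarrow> \<sigma> ! f i < \<sigma> ! f j" using f(3) ij by blast
    also have "\<dots> \<longleftrightarrow> d (\<sigma> ! f i) < d (\<sigma> ! f j)"
      using ne2[OF ij(1)] ne2[OF ij(2)] by (auto simp: d_def)
    finally show ?thesis by (simp add: nth ij)
  qed
  ultimately show ?thesis using m(1) unfolding subperm_def by blast
qed

text \<open>The values are exactly \<open>1\<close> to \<open>length p\<close>, so the relative
  order alone determines them.\<close>

lemma is_perm_nth:
  assumes "is_perm p" "i < length p"
  shows "p ! i = card {j. j < length p \<and> p ! j \<le> p ! i}"
proof -
  have inj: "inj_on ((!) p) {j. j < length p \<and> p ! j \<le> p ! i}"
    using assms by (auto simp: is_perm_def inj_on_def nth_eq_iff_index_eq)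
  have "(!) p ` {j. j < length p \<and> p ! j \<le> p ! i} = {v \<in> set p. v \<le> p ! i}"
    by (auto simp: in_set_conv_nth)
  also have "\<dots> = {1..p ! i}"
    using assms nth_mem[of i p] by (auto simp: is_perm_def)
  finally show ?thesis using card_image[OF inj] by simp
qed

lemma subperm_same_length:
  assumes "subperm \<tau> \<sigma>" "length \<tau> = length \<sigma>" "is_perm \<tau>" "is_perm \<sigma>"
  shows "\<tau> = \<sigma>"
proof -
  obtain f where f: "strict_mono_on {..<length \<tau>} f" "\<forall>i<length \<tau>. f i < length \<sigma>"
    "\<forall>i<length \<tau>. \<forall>j<length \<tau>. \<tau> ! i < \<tau> ! j \<longleftrightarrow> \<sigma> ! f i < \<sigma> ! f j"
    using assms(1) by (auto simp: subperm_def)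
  have inj: "inj_on f {..<length \<tau>}" using f(1) by (rule strict_mono_on_imp_inj_on)
  \<comment> \<open>A strictly increasing self-map of an initial segment is the identity:
    \<open>f i\<close> is bounded below by the positions before \<open>i\<close> and above by the
    \<open>k\<close> positions after it.\<close>
  have ge: "i \<le> f i" if "i < length \<tau>" for i
    using that
  proof (induction i)
    case (Suc i)
    then have "f i < f (Suc i)" using strict_mono_onD[OF f(1), of i "Suc i"] by simp
    with Suc show ?case by simp
  qed simp
  have le: "f i + k < length \<tau>" if "i + k < length \<tau>" for i k
    using that
  proof (induction k arbitrary: i)
    case 0
    then show ?case using f(2) assms(2) by simp
  next
    case (Suc k)
    then have "f i < f (Suc i)" using strict_mono_onD[OF f(1), of i "Suc i"] by simp
    moreover have "f (Suc i) + k < length \<tau>" using Suc by simp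
    ultimately show ?case by simp
  qed
  have id: "f i = i" if "i < length \<tau>" for i
    using le[of i "length \<tau> - 1 - i"] ge[of i] that by linarith
  have "\<tau> ! i = \<sigma> ! i" if i: "i < length \<tau>" for i
  proof -
    have "\<tau> ! j \<le> \<tau> ! i \<longleftrightarrow> \<sigma> ! j \<le> \<sigma> ! i" if "j < length \<tau>" for j
      using f(3) i that id by (metis not_less)
    then have "{j. j < length \<tau> \<and> \<tau> ! j \<le> \<tau> ! i} = {j. j < length \<sigma> \<and> \<sigma> ! j \<le> \<sigma> ! i}"
      using assms(2) by auto
    then show ?thesis using is_perm_nth[of \<tau> i] is_perm_nth[of \<sigma> i] assms i by simp
  qed
  then show ?thesis using assms(2) by (simp add: nth_equalityI)
qed

text \<open>Closure under single deletions suffices: a shorter pattern survives some deletion, until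
  the lengths agree and the pattern is the whole permutation.\<close>

lemma perm_class_codes:
  assumes valid: "\<forall>c\<in>X. valid_code c"
    and closed: "\<forall>c\<in>X. \<forall>i<length c. code_delete i c \<in> X"
  shows "perm_class (perm_of_code ` X)"
proof -
  have "\<tau> \<in> perm_of_code ` X" if "c \<in> X" "is_perm \<tau>" "subperm \<tau> (perm_of_code c)" for c \<tau>
    using that
  proof (induction "length c" arbitrary: c rule: less_induct)
    case less
    have perm: "is_perm (perm_of_code c)"
      using less.prems valid by (simp add: is_perm_perm_of_code)
    obtain f where "strict_mono_on {..<length \<tau>} f" "\<forall>i<length \<tau>. f i < length c"
      using less.prems(3) by (auto simp: subperm_def)
    then have "length \<tau> \<le> length c"
      using card_inj_on_le[of f "{..<length \<tau>}" "{..<length c}"]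
      by (auto dest: strict_mono_on_imp_inj_on)
    show ?case
    proof (cases "length \<tau> = length c")
      case True
      then show ?thesis
        using subperm_same_length[OF less.prems(3)] less.prems perm by simp
    next
      case False
      then obtain i where i: "i < length c" "subperm \<tau> (perm_delete i (perm_of_code c))"
        using subperm_perm_delete[OF less.prems(3)] \<open>length \<tau> \<le> length c\<close> perm
        by (auto simp: is_perm_def)
      show ?thesis
      proof (rule less.hyps[of "code_delete i c"])
        show "length (code_delete i c) < length c" using i(1) by (simp add: length_code_delete)
        show "code_delete i c \<in> X" using closed less.prems(1) i(1) by blast
        show "subperm \<tau> (perm_of_code (code_delete i c))"
          using i perm_delete_perm_of_code valid less.prems(1) by simp
      qed (fact less.prems)
    qed
  qed
  then show ?thesis
    using valid by (auto simp: perm_class_def is_perm_perm_of_code)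
qed

lemma card_class_level_codes:
  assumes "\<forall>c\<in>X. valid_code c"
  shows "card (class_level (perm_of_code ` X) n) = card {c \<in> X. length c = n}"
proof -
  have "class_level (perm_of_code ` X) n = perm_of_code ` {c \<in> X. length c = n}"
    by (auto simp: class_level_def)
  moreover have "inj_on perm_of_code {c \<in> X. length c = n}"
    using assms by (auto intro: inj_onI perm_of_code_inject)
  ultimately show ?thesis by (simp add: card_image)
qed

section \<open>Codes of caterpillars\<close>

text \<open>A nonempty word \<open>w\<close> stands for the indecomposable permutation whose inversion graph is the
  caterpillar with lower vertices \<open>L\<^sub>0, \<dots>, L\<^sub>m\<close>, consecutive ones joined through one upper vertex,
  and with \<open>w ! i\<close> further upper leaves at \<open>L\<^sub>i\<close>. Its code is \<open>word_code 0 w\<close>. With first argument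
  \<open>1\<close> the vertex \<open>L\<^sub>0\<close> has one more upper neighbour, which belongs to a preceding block.\<close>

fun word_code :: "nat \<Rightarrow> nat list \<Rightarrow> nat list" where
  "word_code k [] = []"
| "word_code k [a] = replicate a 0 @ [a + k]"
| "word_code k (a # b # w) = replicate (Suc a) 0 @ [Suc a + k] @ word_code (Suc 0) (b # w)"

fun blocks_code :: "nat \<Rightarrow> nat list \<Rightarrow> nat list" where
  "blocks_code k [] = []"
| "blocks_code k (a # w) = replicate (Suc a) 0 @ [Suc a + k] @ blocks_code (Suc 0) w"

text \<open>The number of vertices: a lower vertex per letter, an upper vertex between neighbours,
  and the leaves.\<close>

definition word_weight :: "nat list \<Rightarrow> nat" where
  "word_weight w = 2 * length w + sum_list w - 1"

lemma length_word_code: "length (word_code k w) = word_weight w"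
  by (induction k w rule: word_code.induct) (auto simp: word_weight_def)

lemma word_code_append:
  "v \<noteq> [] \<Longrightarrow> word_code k (u @ v) = blocks_code k u @ word_code (if u = [] then k else Suc 0) v"
proof (induction u arbitrary: k)
  case (Cons a u)
  then obtain b w where "u @ v = b # w" by (cases "u @ v") auto
  with Cons.IH[of "Suc 0"] Cons.prems show ?case by simp
qed simp

lemma blocks_code_snoc:
  "blocks_code k (u @ [a]) =
     blocks_code k u @ replicate (Suc a) 0 @ [Suc a + (if u = [] then k else Suc 0)]"
  by (induction u arbitrary: k) auto

text \<open>A connecting vertex with no lower vertex after it is one more leaf of the last lower
  vertex.\<close>

lemma blocks_code_eq_word_code: "blocks_code k (u @ [a]) = word_code k (u @ [Suc a])"
  by (simp add: blocks_code_snoc word_code_append)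

lemma word_code_Suc: "word_code 0 (Suc b # w) = 0 # word_code (Suc 0) (b # w)"
  by (cases w) auto

lemma lower_code_zeros: "lower_code (Suc r) (replicate n 0 @ s) = replicate n 0 @ lower_code (Suc r + n) s"
  by (induction n arbitrary: r) auto

text \<open>Of the earlier entries, later blocks are inverted only with the largest, the connecting
  vertex; an entry of rank at least 2 lies below them.\<close>

lemma lower_code_word_code: "lower_code (Suc (Suc r)) (word_code (Suc 0) w) = word_code (Suc 0) w"
  by (induction "Suc 0" w arbitrary: r rule: word_code.induct)
    (simp_all add: lower_code_zeros del: replicate_Suc)

text \<open>Rank 1 belongs to the connecting vertex; without it the remaining word starts a
  caterpillar of its own.\<close>

lemma lower_code_word_code_1: "lower_code (Suc 0) (word_code (Suc 0) w) = word_code 0 w"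
proof (cases w rule: remdups_adj.cases)
  case (3 a b v)
  then show ?thesis
    using lower_code_word_code[of a "b # v"]
    by (simp add: lower_code_zeros del: replicate_Suc)
qed (auto simp: lower_code_zeros)

lemma valid_word_code_aux: "k \<le> length c \<Longrightarrow> valid_code c \<Longrightarrow> valid_code (c @ word_code k w)"
proof (induction k w arbitrary: c rule: word_code.induct)
  case (2 k a)
  then show ?case by (auto simp: valid_code_append nth_append)
next
  case (3 k a b w)
  have "valid_code (c @ replicate (Suc a) 0 @ [Suc a + k])"
    using 3 by (auto simp: valid_code_append nth_append simp del: replicate_Suc)
  from 3(1)[OF _ this] show ?case by simp
qed simp

lemma valid_word_code: "valid_code (word_code 0 w)"
  using valid_word_code_aux[of 0 "[]"] by simp

text \<open>The zeros of a block increase, so the one at index \<open>i\<close> has rank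
  \<open>n - i\<close> among them; as \<open>n \<le> h\<close>, the lower vertex lies below them
  all.\<close>

lemma code_delete_block_zero:
  assumes "i < n" "n \<le> h"
  shows "code_delete i (replicate n 0 @ h # s) =
    replicate (n - 1) 0 @ (h - 1) # lower_code (n - i) s"
proof -
  have "replicate n 0 = replicate i 0 @ (0::nat) # replicate (n - Suc i) 0"
    using assms by (simp add: replicate_app_Cons_same flip: replicate_Suc replicate_add)
  then have "code_delete i (replicate n 0 @ h # s) =
      replicate i 0 @ lower_code (Suc 0) (replicate (n - Suc i) 0 @ h # s)"
    by (simp add: code_delete_def nth_append)
  also have "\<dots> = replicate i 0 @ replicate (n - Suc i) 0 @ (h - 1) # lower_code (n - i) s"
    using assms by (simp add: lower_code_zeros Suc_diff_Suc)
  finally show ?thesis using assms by (simp flip: replicate_add append_assoc)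
qed

lemma code_delete_block_top:
  "code_delete n (replicate n 0 @ h # s) = replicate n 0 @ lower_code (Suc h) s"
  by (simp add: code_delete_def nth_append)

section \<open>Classes of direct sums of caterpillars\<close>

text \<open>The last condition covers the deletion of a lower vertex: its two neighbours on the path become
  leaves of the adjacent lower vertices.\<close>

definition down_closed :: "nat list set \<Rightarrow> bool" where
  "down_closed S \<longleftrightarrow> [] \<notin> S \<and> [0] \<in> S \<and>
     (\<forall>u a v. u @ Suc a # v \<in> S \<longrightarrow> u @ a # v \<in> S) \<and>
     (\<forall>u a b v. u @ a # b # v \<in> S \<longrightarrow> u @ [Suc a] \<in> S \<and> Suc b # v \<in> S)"

definition sum_codes :: "nat list set \<Rightarrow> nat list set" where
  "sum_codes S = (\<lambda>ws. concat (map (word_code 0) ws)) ` lists S"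

lemma sum_codes_Nil: "[] \<in> sum_codes S"
  by (force simp: sum_codes_def intro: image_eqI[of _ _ "[]"])

lemma sum_codes_append: "c \<in> sum_codes S \<Longrightarrow> d \<in> sum_codes S \<Longrightarrow> c @ d \<in> sum_codes S"
  unfolding sum_codes_def by (force intro: image_eqI[of _ _ "xs @ ys" for xs ys])

lemma sum_codes_word: "w \<in> S \<Longrightarrow> word_code 0 w \<in> sum_codes S"
  by (force simp: sum_codes_def intro: image_eqI[of _ _ "[w]"])

lemma sum_codes_zeros: "[0] \<in> S \<Longrightarrow> replicate n 0 \<in> sum_codes S"
proof (induction n)
  case (Suc n)
  then show ?case
    using sum_codes_append[OF sum_codes_word[of "[0]"], of S "replicate n 0"] by simp
qed (simp add: sum_codes_Nil)

lemma valid_sum_codes: "c \<in> sum_codes S \<Longrightarrow> valid_code c"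
proof -
  have "valid_code (concat (map (word_code 0) ws))" for ws
    by (induction ws) (auto intro: valid_code_append_valid valid_word_code)
  then show "c \<in> sum_codes S \<Longrightarrow> valid_code c" by (auto simp: sum_codes_def)
qed

section \<open>Closure of the sums under deletion of a vertex\<close>

context
  fixes S :: "nat list set"
  assumes S: "down_closed S"
begin

lemma zero_word: "[0] \<in> S"
  using S by (simp add: down_closed_def)

lemma dec_word: "u @ Suc a # v \<in> S \<Longrightarrow> u @ a # v \<in> S"
  using S by (simp add: down_closed_def)

lemma cut_left: "u @ a # b # v \<in> S \<Longrightarrow> u @ [Suc a] \<in> S"
  and cut_right: "u @ a # b # v \<in> S \<Longrightarrow> Suc b # v \<in> S"
  using S by (simp_all add: down_closed_def)

lemma sum_codes_blocks:
  assumes "u @ a # v \<in> S"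
  shows "blocks_code 0 u \<in> sum_codes S"
proof (cases u rule: rev_cases)
  case Nil
  then show ?thesis by (simp add: sum_codes_Nil)
next
  case (snoc u' b)
  then have "u' @ [Suc b] \<in> S" using cut_left[of u' b a v] assms by simp
  then show ?thesis using snoc by (simp add: blocks_code_eq_word_code sum_codes_word)
qed

text \<open>Induction along the word, \<open>u\<close> being the part already passed. The first
  argument of \<open>word_code\<close> is \<open>Suc 0\<close> when a connecting vertex comes from
  \<open>u\<close>.\<close>

lemma code_delete_word_aux:
  assumes "u @ v \<in> S" "i < length (word_code (if u = [] then 0 else Suc 0) v)"
  shows "blocks_code 0 u @ code_delete i (word_code (if u = [] then 0 else Suc 0) v) \<in> sum_codes S"
  using assms
proof (induction v arbitrary: u i)
  case (Cons a v)
  define k where "k = (if u = [] then 0 else Suc 0 :: nat)"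
  have u: "blocks_code 0 u \<in> sum_codes S" by (rule sum_codes_blocks) (fact Cons.prems(1))
  show ?case
  proof (cases v)
    case Nil
    show ?thesis
    proof (cases "i < a")
      case True
      then obtain a' where a: "a = Suc a'" by (cases a) auto
      have "u @ [a'] \<in> S" using dec_word[of u a' "[]"] Cons.prems(1) Nil a by simp
      then have "blocks_code 0 u @ word_code k [a'] \<in> sum_codes S"
        using sum_codes_word[of "u @ [a']"] by (simp add: word_code_append k_def)
      moreover have "code_delete i (word_code k [a]) = word_code k [a']"
        using code_delete_block_zero[of i a "a + k" "[]"] True by (simp add: a)
      ultimately show ?thesis using Nil by (simp add: k_def)
    next
      case False
      \<comment> \<open>The last lower vertex goes: its leaves become isolated, and the connecting
        vertex from \<open>u\<close> becomes a leaf there.\<close>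
      then have "i = a" using Cons.prems(2) Nil by simp
      then have "code_delete i (word_code k [a]) = replicate a 0"
        using code_delete_block_top[of a "a + k" "[]"] by simp
      then show ?thesis
        using sum_codes_append[OF u sum_codes_zeros[OF zero_word, of a]] Nil
        by (simp add: k_def)
    qed
  next
    case (Cons b v')
    have S': "u @ a # b # v' \<in> S" using Cons.prems(1) Cons by simp
    have code: "word_code k (a # v) = replicate (Suc a) 0 @ (Suc a + k) # word_code (Suc 0) (b # v')"
      using Cons by simp
    \<comment> \<open>Indices below \<open>a\<close> are leaves, \<open>a\<close> is the connecting
      vertex to the next lower vertex, and \<open>Suc a\<close> is the lower vertex itself.\<close>
    consider "i < a" | "i = a" | "i = Suc a" | "i \<ge> Suc (Suc a)" by linarith
    then show ?thesis
    proof cases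
      case 1
      then obtain a' where a: "a = Suc a'" by (cases a) auto
      have r: "Suc a - i = Suc (Suc (a - Suc i))" using 1 by simp
      have "code_delete i (word_code k (a # v)) = word_code k (a' # b # v')"
        unfolding code
        by (subst code_delete_block_zero) (use 1 r in \<open>simp_all add: lower_code_word_code a
            del: replicate_Suc\<close>)
      moreover have "u @ a' # b # v' \<in> S" using dec_word[of u a' "b # v'"] S' a by simp
      ultimately show ?thesis
        using sum_codes_word[of "u @ a' # b # v'"] by (simp add: word_code_append k_def)
    next
      case 2
      \<comment> \<open>Without the connecting vertex the caterpillar falls into two.\<close>
      have "code_delete i (word_code k (a # v)) = word_code k [a] @ word_code 0 (b # v')"
        unfolding code
        by (subst code_delete_block_zero) (use 2 lower_code_word_code_1 in
            \<open>simp_all del: replicate_Suc\<close>)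
      moreover have "u @ [a] \<in> S" using dec_word[of u a "[]"] cut_left[OF S'] by simp
      moreover have "b # v' \<in> S" using dec_word[of "[]" b v'] cut_right[OF S'] by simp
      ultimately show ?thesis
        using sum_codes_append[OF sum_codes_word[of "u @ [a]"] sum_codes_word[of "b # v'"]]
        by (simp add: word_code_append k_def)
    next
      case 3
      \<comment> \<open>The leaves become isolated, and the last zero, formerly the connecting
        vertex, becomes a leaf of the next lower vertex, hence \<open>Suc b\<close>.\<close>
      have "code_delete i (word_code k (a # v)) = replicate (Suc a) 0 @ word_code (Suc 0) (b # v')"
        unfolding code 3
        by (subst code_delete_block_top) (use lower_code_word_code in \<open>simp del: replicate_Suc\<close>)
      also have "\<dots> = replicate a 0 @ word_code 0 (Suc b # v')"
        by (simp add: word_code_Suc replicate_app_Cons_same)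
      finally show ?thesis
        using sum_codes_append[OF u sum_codes_append[OF sum_codes_zeros[OF zero_word, of a]
              sum_codes_word[OF cut_right[OF S']]]]
        by (simp add: k_def)
    next
      case 4
      define j where "j = i - Suc (Suc a)"
      have i: "i = length (replicate (Suc a) 0 @ [Suc a + k]) + j" using 4 by (simp add: j_def)
      have "code_delete i (word_code k (a # v)) =
          (replicate (Suc a) 0 @ [Suc a + k]) @ code_delete j (word_code (Suc 0) v)"
        unfolding i using code_delete_append2[of "replicate (Suc a) 0 @ [Suc a + k]" j "word_code (Suc 0) v"]
        by (simp add: code Cons del: replicate_Suc)
      moreover have "blocks_code 0 (u @ [a]) @ code_delete j (word_code (Suc 0) v) \<in> sum_codes S"
        using Cons.IH[of "u @ [a]" j] Cons.prems 4 Cons by (auto simp: j_def)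
      ultimately show ?thesis by (simp add: blocks_code_snoc k_def)
    qed
  qed
qed simp

lemma code_delete_sum_codes:
  assumes "c \<in> sum_codes S" "i < length c"
  shows "code_delete i c \<in> sum_codes S"
proof -
  obtain ws where ws: "ws \<in> lists S" "c = concat (map (word_code 0) ws)"
    using assms(1) by (auto simp: sum_codes_def)
  have "code_delete i (concat (map (word_code 0) ws)) \<in> sum_codes S"
    using ws(1) assms(2)[unfolded ws(2)]
  proof (induction ws arbitrary: i)
    case (Cons w ws)
    let ?d = "concat (map (word_code 0) ws)"
    have d: "?d \<in> sum_codes S" using Cons by (auto simp: sum_codes_def)
    have w: "w \<in> S" using Cons by simp
    show ?case
    proof (cases "i < length (word_code 0 w)")
      case True
      then have "code_delete i (word_code 0 w) \<in> sum_codes S"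
        using code_delete_word_aux[of "[]" w i] w by simp
      then show ?thesis
        using True d by (simp add: code_delete_append1 valid_sum_codes sum_codes_append)
    next
      case False
      define j where "j = i - length (word_code 0 w)"
      have "i = length (word_code 0 w) + j" using False by (simp add: j_def)
      moreover from this have "j < length ?d" using Cons.prems by simp
      ultimately show ?thesis
        using Cons.IH[of j] Cons.prems w
        by (simp add: code_delete_append2 sum_codes_append sum_codes_word)
    qed
  qed simp
  then show ?thesis by (simp add: ws)
qed

lemma perm_class_sum_codes: "perm_class (perm_of_code ` sum_codes S)"
  by (rule perm_class_codes) (auto intro: valid_sum_codes code_delete_sum_codes)

end

text \<open>No proper suffix of the code of a caterpillar is a valid code, so a concatenation of such
  codes can be parsed uniquely from the right.\<close>

lemma suffix_block:
  assumes "replicate n 0 @ h # s = c @ d" "h \<ge> n" "c \<noteq> [] \<or> h > n" "valid_code d" "d \<noteq> []"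
  shows "\<exists>e. s = e @ d"
proof (cases "length c \<le> n")
  case True
  \<comment> \<open>If the cut falls before \<open>h\<close>, then \<open>h\<close> stands at index
    \<open>n - length c\<close> of \<open>d\<close>, where validity makes it too small.\<close>
  have "d = drop (length c) (replicate n 0 @ h # s)" using assms(1) by simp
  also have "\<dots> = replicate (n - length c) 0 @ h # s" using True by simp
  finally have "d ! (n - length c) = h" "n - length c < length d" by (simp_all add: nth_append)
  then have "h \<le> n - length c" using assms(4) by (metis valid_code_def)
  then show ?thesis using assms(2,3) True by (cases c) auto
next
  case False
  then have "s = drop (Suc n) c @ d"
    using arg_cong[OF assms(1), of "drop (Suc n)"] by simp
  then show ?thesis ..
qed

lemma suffix_word_code:
  assumes "word_code k w = c @ d" "c \<noteq> [] \<or> k > 0" "valid_code d"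
  shows "d = []"
  using assms
proof (induction k w arbitrary: c rule: word_code.induct)
  case (2 k a)
  then show ?case using suffix_block[of a "a + k" "[]" c d] by auto
next
  case (3 k a b w)
  then show ?case using suffix_block[of "Suc a" "Suc a + k" "word_code (Suc 0) (b # w)" c d]
    by auto
qed simp

lemma replicate_zeros_inject:
  "replicate m 0 @ x # s = replicate n 0 @ y # t \<Longrightarrow> x > 0 \<Longrightarrow> y > 0 \<Longrightarrow> m = n \<and> x = y \<and> s = (t :: nat list)"
proof (induction m arbitrary: n)
  case 0
  then show ?case by (cases n) auto
next
  case (Suc m)
  then show ?case by (cases n) auto
qed

lemma word_code_eq_Nil [simp]: "word_code k w = [] \<longleftrightarrow> w = []"
  by (induction k w rule: word_code.induct) auto

lemma word_code_Cons:
  "word_code k (a # w) = (let n = if w = [] then a else Suc a in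
     replicate n 0 @ (n + k) # word_code (Suc 0) w)"
  by (cases w) auto

text \<open>The first positive entry ends the first block and reveals its size; the rest is
  induction.\<close>

lemma word_code_inject: "word_code k v = word_code k w \<Longrightarrow> v = w"
proof (induction v arbitrary: k w)
  case Nil
  then show ?case by (metis word_code_eq_Nil)
next
  case (Cons a v)
  then obtain b u where w: "w = b # u" by (metis word_code_eq_Nil list.exhaust)
  define m where "m = (if v = [] then a else Suc a)"
  define n where "n = (if u = [] then b else Suc b)"
  have eq: "replicate m 0 @ (m + k) # word_code (Suc 0) v =
      replicate n 0 @ (n + k) # word_code (Suc 0) u"
    using Cons.prems by (simp add: w word_code_Cons Let_def m_def n_def)
  have len: "m + length (word_code (Suc 0) v) = n + length (word_code (Suc 0) u)"
    using arg_cong[OF eq, of length] by simp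
  \<comment> \<open>Only the single vertex \<open>[0]\<close> with \<open>k = 0\<close> has a block
    without positive entry; there the lengths decide.\<close>
  consider "m + k > 0" "n + k > 0" | "m = 0" "k = 0" | "n = 0" "k = 0" by linarith
  then have "m = n \<and> word_code (Suc 0) v = word_code (Suc 0) u"
  proof cases
    case 1
    then show ?thesis using replicate_zeros_inject[OF eq] by simp
  next
    case 2
    then have "v = []" by (simp add: m_def split: if_splits)
    then show ?thesis using len 2 by simp
  next
    case 3
    then have "u = []" by (simp add: n_def split: if_splits)
    then show ?thesis using len 3 by simp
  qed
  then have "m = n" "v = u" using Cons.IH by blast+
  then show ?case by (simp add: w m_def n_def split: if_splits)
qed

lemma inj_sum_codes:
  assumes "[] \<notin> S"
  shows "inj_on (\<lambda>ws. concat (map (word_code 0) ws)) (lists S)"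
proof (rule inj_onI)
  fix vs ws
  assume "vs \<in> lists S" "ws \<in> lists S"
    "concat (map (word_code 0) vs) = concat (map (word_code 0) ws)"
  then show "vs = ws"
  proof (induction vs arbitrary: ws rule: rev_induct)
    case Nil
    then show ?case using assms by (cases ws) auto
  next
    case (snoc v vs)
    have v: "v \<noteq> []" using snoc.prems(1) assms by auto
    obtain us w where ws: "ws = us @ [w]"
      using snoc.prems(3) v by (cases ws rule: rev_cases) auto
    have w: "w \<noteq> []" using snoc.prems(2) assms ws by auto
    have eq: "concat (map (word_code 0) vs) @ word_code 0 v =
        concat (map (word_code 0) us) @ word_code 0 w"
      using snoc.prems(3) ws by simp
    \<comment> \<open>Of the two last summands one is a suffix of the other; being valid, it cannot
      be a proper one.\<close>
    then obtain e where "word_code 0 v = e @ word_code 0 w \<or> word_code 0 w = e @ word_code 0 v"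
      unfolding append_eq_append_conv2 by metis
    then have "word_code 0 v = word_code 0 w"
      using suffix_word_code[of 0 v e] suffix_word_code[of 0 w e] v w
      by (cases "e = []") (auto simp: valid_word_code)
    then show ?case using snoc.IH[of us] snoc.prems(1,2) eq ws word_code_inject by auto
  qed
qed

section \<open>Growth of weighted free monoids\<close>

context
  fixes S :: "'a set" and wt :: "'a \<Rightarrow> nat"
  assumes wt_pos: "\<And>w. w \<in> S \<Longrightarrow> wt w > 0"
    and fin: "\<And>n. finite {w \<in> S. wt w \<le> n}"
begin

definition words_of_weight :: "nat \<Rightarrow> 'a list set" where
  "words_of_weight n = {ws \<in> lists S. sum_list (map wt ws) = n}"

lemma words_of_weight_0: "words_of_weight 0 = {[]}"
proof -
  have "ws = []" if "ws \<in> lists S" "sum_list (map wt ws) = 0" for ws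
    using that wt_pos by (cases ws) force+
  then show ?thesis by (auto simp: words_of_weight_def)
qed

lemma words_of_weight_rec:
  assumes "n > 0"
  shows "words_of_weight n = (\<Union>w\<in>{w \<in> S. wt w \<le> n}. (#) w ` words_of_weight (n - wt w))"
proof (intro equalityI subsetI)
  fix ws assume ws: "ws \<in> words_of_weight n"
  with assms obtain w vs where "ws = w # vs" by (cases ws) (auto simp: words_of_weight_def)
  with ws show "ws \<in> (\<Union>w\<in>{w \<in> S. wt w \<le> n}. (#) w ` words_of_weight (n - wt w))"
    by (auto simp: words_of_weight_def intro!: exI[of _ w])
qed (auto simp: words_of_weight_def)

lemma finite_words_of_weight: "finite (words_of_weight n)"
proof (induction n rule: less_induct)
  case (less n)
  show ?case
  proof (cases "n = 0")
    case False
    then show ?thesis using less wt_pos fin by (auto simp: words_of_weight_rec)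
  qed (simp add: words_of_weight_0)
qed

lemma card_words_of_weight_rec:
  assumes "n > 0"
  shows "card (words_of_weight n) = (\<Sum>w | w \<in> S \<and> wt w \<le> n. card (words_of_weight (n - wt w)))"
  unfolding words_of_weight_rec[OF assms]
  by (subst card_UN_disjoint) (auto simp: fin finite_words_of_weight card_image)

text \<open>By induction a first letter \<open>w\<close> contributes at most
  \<open>\<gamma> ^ n * (1 / \<gamma>) ^ wt w\<close>, and the letters of \<open>S\<close> have
  total weight 1.\<close>

lemma card_words_of_weight_le:
  assumes "\<gamma> > 0" "((\<lambda>w. (1 / \<gamma>) ^ wt w) has_sum 1) S"
  shows "real (card (words_of_weight n)) \<le> \<gamma> ^ n"
proof (induction n rule: less_induct)
  case (less n)
  show ?case
  proof (cases "n = 0")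
    case False
    let ?W = "{w \<in> S. wt w \<le> n}"
    have "real (card (words_of_weight n)) = (\<Sum>w\<in>?W. real (card (words_of_weight (n - wt w))))"
      using False by (simp add: card_words_of_weight_rec)
    also have "\<dots> \<le> (\<Sum>w\<in>?W. \<gamma> ^ n * (1 / \<gamma>) ^ wt w)"
    proof (rule sum_mono)
      fix w assume w: "w \<in> ?W"
      then have "real (card (words_of_weight (n - wt w))) \<le> \<gamma> ^ (n - wt w)"
        using less wt_pos False by simp
      also have "\<dots> = \<gamma> ^ n * (1 / \<gamma>) ^ wt w"
        using w assms(1) by (simp add: power_diff field_simps)
      finally show "real (card (words_of_weight (n - wt w))) \<le> \<gamma> ^ n * (1 / \<gamma>) ^ wt w" .
    qed
    also have "\<dots> = \<gamma> ^ n * (\<Sum>w\<in>?W. (1 / \<gamma>) ^ wt w)" by (simp add: sum_distrib_left)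
    also have "\<dots> \<le> \<gamma> ^ n * 1"
      using finite_sum_le_has_sum[OF assms(2) fin[of n]] assms(1) by (intro mult_left_mono) auto
    finally show ?thesis by simp
  qed (simp add: words_of_weight_0)
qed

text \<open>For \<open>l < \<gamma>\<close> finitely many letters already have total weight at least
  1 at \<open>1 / l\<close>, and the recursion restricted to them preserves a bound of order
  \<open>l ^ n\<close>.\<close>

lemma card_words_of_weight_ge:
  assumes "1 < l" "l < \<gamma>" "((\<lambda>w. (1 / \<gamma>) ^ wt w) has_sum 1) S"
    and unit: "e \<in> S" "wt e = 1"
  shows "\<exists>K. \<forall>n. l ^ n / l ^ K \<le> real (card (words_of_weight n))"
proof -
  \<comment> \<open>A partial sum above \<open>l / \<gamma>\<close> is enough: since each weight is
    at least 1, passing from \<open>1 / \<gamma>\<close> to \<open>1 / l\<close> gains a factor of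
    at least \<open>\<gamma> / l\<close>.\<close>
  have "\<forall>\<^sub>F T in finite_subsets_at_top S. l / \<gamma> < (\<Sum>w\<in>T. (1 / \<gamma>) ^ wt w)"
    using assms(1-3) by (intro order_tendstoD(1)[of _ 1]) (auto simp: has_sum_def)
  then obtain T where T: "finite T" "T \<subseteq> S" "l / \<gamma> < (\<Sum>w\<in>T. (1 / \<gamma>) ^ wt w)"
    unfolding eventually_finite_subsets_at_top by blast
  have "1 \<le> \<gamma> / l * (\<Sum>w\<in>T. (1 / \<gamma>) ^ wt w)"
    using T(3) assms(1,2) by (simp add: field_simps)
  also have "\<dots> = (\<Sum>w\<in>T. \<gamma> / l * (1 / \<gamma>) ^ wt w)" by (rule sum_distrib_left)
  also have "\<dots> \<le> (\<Sum>w\<in>T. (1 / l) ^ wt w)"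
  proof (rule sum_mono)
    fix w assume "w \<in> T"
    then have "wt w \<ge> 1" using T(2) wt_pos by (auto simp: Suc_le_eq)
    then have "\<gamma> / l \<le> (\<gamma> / l) ^ wt w"
      using assms(1,2) power_increasing[of 1 "wt w" "\<gamma> / l"] by simp
    then have "\<gamma> / l * (1 / \<gamma>) ^ wt w \<le> (\<gamma> / l) ^ wt w * (1 / \<gamma>) ^ wt w"
      using assms(1,2) by (intro mult_right_mono) auto
    also have "\<dots> = (1 / l) ^ wt w"
      using assms(1,2) by (simp flip: power_mult_distrib)
    finally show "\<gamma> / l * (1 / \<gamma>) ^ wt w \<le> (1 / l) ^ wt w" .
  qed
  finally have T1: "1 \<le> (\<Sum>w\<in>T. (1 / l) ^ wt w)" .
  define K where "K = (\<Sum>w\<in>T. wt w)"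
  have K: "wt w \<le> K" if "w \<in> T" for w
    unfolding K_def using T(1) that by (intro member_le_sum) auto
  have "l ^ n / l ^ K \<le> real (card (words_of_weight n))" for n
  proof (induction n rule: less_induct)
    case (less n)
    show ?case
    proof (cases "n \<le> K")
      case True
      \<comment> \<open>The letter of weight 1 provides a word of every weight, which starts the
        induction.\<close>
      have "replicate n e \<in> words_of_weight n"
        using unit by (auto simp: words_of_weight_def sum_list_replicate)
      then have "1 \<le> card (words_of_weight n)"
        using finite_words_of_weight by (auto simp: Suc_le_eq card_gt_0_iff)
      moreover have "l ^ n / l ^ K \<le> 1"
        using assms(1) True by (simp add: power_increasing)
      ultimately show ?thesis by simp
    next
      case False
      then have "l ^ n / l ^ K * 1 \<le> l ^ n / l ^ K * (\<Sum>w\<in>T. (1 / l) ^ wt w)"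
        using T1 assms(1) by (intro mult_left_mono) auto
      also have "\<dots> = (\<Sum>w\<in>T. l ^ n / l ^ K * (1 / l) ^ wt w)" by (rule sum_distrib_left)
      also have "\<dots> \<le> (\<Sum>w\<in>T. real (card (words_of_weight (n - wt w))))"
      proof (rule sum_mono)
        fix w assume w: "w \<in> T"
        then have "wt w \<le> n" "wt w > 0" using False K T(2) wt_pos by fastforce+
        then have "l ^ (n - wt w) / l ^ K \<le> real (card (words_of_weight (n - wt w)))"
          using less[of "n - wt w"] by simp
        moreover have "l ^ (n - wt w) / l ^ K = l ^ n / l ^ K * (1 / l) ^ wt w"
          using \<open>wt w \<le> n\<close> assms(1) by (simp add: power_diff field_simps)
        ultimately show "l ^ n / l ^ K * (1 / l) ^ wt w \<le> real (card (words_of_weight (n - wt w)))"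
          by simp
      qed
      also have "\<dots> \<le> (\<Sum>w | w \<in> S \<and> wt w \<le> n. real (card (words_of_weight (n - wt w))))"
        using T(2) K False fin by (intro sum_mono2) fastforce+
      also have "\<dots> = real (card (words_of_weight n))"
        using False by (simp add: card_words_of_weight_rec)
      finally show ?thesis by simp
    qed
  qed
  then show ?thesis by blast
qed

lemma words_of_weight_growth:
  assumes "\<gamma> > 1" "((\<lambda>w. (1 / \<gamma>) ^ wt w) has_sum 1) S" "e \<in> S" "wt e = 1"
  shows "(\<lambda>n. real (card (words_of_weight n)) powr (1 / real n)) \<longlonglongrightarrow> \<gamma>"
proof (rule order_tendstoI)
  fix a assume a: "a < \<gamma>"
  define l where "l = (max a 1 + \<gamma>) / 2"
  have l: "1 < l" "a < l" "l < \<gamma>" using a assms(1) by (auto simp: l_def max_def)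
  obtain K where K: "l ^ n / l ^ K \<le> real (card (words_of_weight n))" for n
    using card_words_of_weight_ge[OF l(1,3) assms(2-4)] by blast
  have "(\<lambda>n. l * (1 / l ^ K) powr (1 / real n)) \<longlonglongrightarrow> l * (1 / l ^ K) powr 0"
    using l(1) by (intro tendsto_intros lim_1_over_n) auto
  then have "(\<lambda>n. l * (1 / l ^ K) powr (1 / real n)) \<longlonglongrightarrow> l" using l(1) by simp
  then have "\<forall>\<^sub>F n in sequentially. a < l * (1 / l ^ K) powr (1 / real n)"
    using l(2) by (rule order_tendstoD)
  moreover have "\<forall>\<^sub>F n :: nat in sequentially. n > 0" by (rule eventually_gt_at_top)
  ultimately show "\<forall>\<^sub>F n in sequentially. a < real (card (words_of_weight n)) powr (1 / real n)"
  proof eventually_elim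
    case (elim n)
    have "(l ^ n) powr (1 / real n) = l"
      using l(1) elim(2) by (simp add: powr_powr flip: powr_realpow)
    then have "l * (1 / l ^ K) powr (1 / real n) = (l ^ n / l ^ K) powr (1 / real n)"
      using l(1) powr_mult[of "l ^ n" "1 / l ^ K" "1 / real n"] by simp
    also have "\<dots> \<le> real (card (words_of_weight n)) powr (1 / real n)"
      using K[of n] l(1) by (intro powr_mono2) auto
    finally show ?case using elim by simp
  qed
next
  fix a assume a: "\<gamma> < a"
  have "\<forall>\<^sub>F n :: nat in sequentially. n > 0" by (rule eventually_gt_at_top)
  then show "\<forall>\<^sub>F n in sequentially. real (card (words_of_weight n)) powr (1 / real n) < a"
  proof eventually_elim
    case (elim n)
    have "real (card (words_of_weight n)) powr (1 / real n) \<le> (\<gamma> ^ n) powr (1 / real n)"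
      using card_words_of_weight_le[OF _ assms(2)] assms(1) by (intro powr_mono2) auto
    also have "\<dots> = \<gamma>" using assms(1) elim by (simp add: powr_powr flip: powr_realpow)
    finally show ?case using a by simp
  qed
qed

end

text \<open>Unique parsing identifies the codes of length \<open>n\<close> with the words over
  \<open>S\<close> of weight \<open>n\<close>.\<close>

lemma growth_rate_sum_codes:
  assumes S: "down_closed S" and \<gamma>: "\<gamma> > 1"
    and sum: "((\<lambda>w. (1 / \<gamma>) ^ word_weight w) has_sum 1) S"
  shows "growth_rate (perm_of_code ` sum_codes S) \<gamma>"
proof -
  have nonempty: "[] \<notin> S" and zero: "[0] \<in> S" using S by (simp_all add: down_closed_def)
  have unit: "word_weight [0] = 1" by (simp add: word_weight_def)
  have pos: "word_weight w > 0" if "w \<in> S" for w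
    using that nonempty by (cases w) (auto simp: word_weight_def)
  have fin: "finite {w \<in> S. word_weight w \<le> n}" for n
  proof (rule finite_subset)
    show "{w \<in> S. word_weight w \<le> n} \<subseteq> {w. set w \<subseteq> {..Suc n} \<and> length w \<le> Suc n}"
    proof (rule subsetI, rule CollectI, rule conjI)
      fix w assume w: "w \<in> {w \<in> S. word_weight w \<le> n}"
      then have "2 * length w + sum_list w \<le> Suc n" by (auto simp: word_weight_def)
      then show "length w \<le> Suc n" "set w \<subseteq> {..Suc n}"
        using member_le_sum_list[of _ w] by fastforce+
    qed
    show "finite {w. set w \<subseteq> {..Suc n} \<and> length w \<le> Suc n}"
      by (rule finite_lists_length_le) simp
  qed
  have "card (class_level (perm_of_code ` sum_codes S) n) = card (words_of_weight S word_weight n)"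
    for n
  proof -
    let ?f = "\<lambda>ws. concat (map (word_code 0) ws)"
    have len: "length (?f ws) = sum_list (map word_weight ws)" for ws
      by (induction ws) (auto simp: length_word_code)
    have "{c \<in> sum_codes S. length c = n} = ?f ` words_of_weight S word_weight n"
      by (auto simp: sum_codes_def words_of_weight_def[OF pos fin] len simp del: length_concat)
    moreover have "inj_on ?f (words_of_weight S word_weight n)"
      using inj_sum_codes[OF nonempty] by (rule inj_on_subset) (auto simp: words_of_weight_def[OF pos fin])
    ultimately show ?thesis
      by (simp add: card_class_level_codes valid_sum_codes card_image)
  qed
  then show ?thesis
    using words_of_weight_growth[OF pos fin \<gamma> sum zero unit] by (simp add: growth_rate_def)
qed

section \<open>A family of caterpillars with forked ends\<close>

text \<open>Right ends are written mirrored. A fork is a member of \<open>high_ends\<close>; each fork contains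
  the fork \<open>[2]\<close>, for \<open>[0, 1]\<close> with a vertex of the path as second leaf.\<close>

definition low_ends :: "nat list set" where "low_ends = {[0], [1]}"
definition high_ends :: "nat list set" where "high_ends = {[2], [3], [0, 1]}"
definition low_pairs :: "(nat list \<times> nat list) set" where
  "low_pairs = low_ends \<times> (low_ends \<union> high_ends) \<union> high_ends \<times> low_ends"

definition caterpillar :: "nat list \<Rightarrow> nat \<Rightarrow> nat list \<Rightarrow> nat list" where
  "caterpillar P k Q = P @ replicate k 0 @ rev Q"

text \<open>\<open>D k\<close> holds the pairs of forks allowed at distance \<open>k\<close>. The
  bound 4 comes from cutting behind an end \<open>[3]\<close>, which turns the connecting vertex
  into a fourth leaf.\<close>

definition caterpillars :: "(nat \<Rightarrow> (nat list \<times> nat list) set) \<Rightarrow> nat list set" where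
  "caterpillars D = (\<lambda>a. [a]) ` {..4} \<union>
     (\<lambda>(k, P, Q). caterpillar P k Q) ` (SIGMA k:UNIV. low_pairs \<union> D k)"

text \<open>\<open>[2]\<close> arises from \<open>[3]\<close> by losing a leaf and from
  \<open>[0, 1]\<close> by cutting off its last lower vertex; both keep the distance.\<close>

definition fork_closed :: "(nat list \<times> nat list) set \<Rightarrow> bool" where
  "fork_closed D \<longleftrightarrow> D \<subseteq> high_ends \<times> high_ends \<and> (\<forall>(P, Q)\<in>D. ([2], Q) \<in> D \<and> (P, [2]) \<in> D)"

lemma rev_caterpillar: "rev (caterpillar P k Q) = caterpillar Q k P"
  by (simp add: caterpillar_def)

lemma converse_low_pairs [simp]: "low_pairs\<inverse> = low_pairs"
  by (auto simp: low_pairs_def)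

lemma caterpillars_cases:
  assumes "w \<in> caterpillars D"
  obtains (single) a where "a \<le> 4" "w = [a]"
  | (caterpillar) k P Q where "(P, Q) \<in> low_pairs \<union> D k" "w = caterpillar P k Q"
  using assms by (auto simp: caterpillars_def)

lemma singleton_caterpillars: "a \<le> 4 \<Longrightarrow> [a] \<in> caterpillars D"
  by (simp add: caterpillars_def)

lemma caterpillar_in_caterpillars:
  "(P, Q) \<in> low_pairs \<union> D k \<Longrightarrow> caterpillar P k Q \<in> caterpillars D"
  by (force simp: caterpillars_def)

lemma rev_caterpillars:
  assumes "w \<in> caterpillars D"
  shows "rev w \<in> caterpillars (\<lambda>k. (D k)\<inverse>)"
  using assms
proof (cases rule: caterpillars_cases)
  case (caterpillar k P Q)
  then have "(Q, P) \<in> low_pairs \<union> (D k)\<inverse>"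
    using converse_low_pairs by blast
  then show ?thesis using caterpillar by (simp add: rev_caterpillar caterpillar_in_caterpillars)
qed (simp add: singleton_caterpillars)

lemma rev_caterpillars_iff: "rev w \<in> caterpillars (\<lambda>k. (D k)\<inverse>) \<longleftrightarrow> w \<in> caterpillars D"
  using rev_caterpillars[of w D] rev_caterpillars[of "rev w" "\<lambda>k. (D k)\<inverse>"] by auto

section \<open>Closure of the family under the operations of \<open>down_closed\<close>\<close>

lemma fork_closed_converse: "fork_closed D \<Longrightarrow> fork_closed (D\<inverse>)"
  by (auto simp: fork_closed_def)

lemma pairs_ends:
  assumes "fork_closed D" "(P, Q) \<in> low_pairs \<union> D"
  shows "P \<in> low_ends \<union> high_ends" "Q \<in> low_ends \<union> high_ends"
  using assms by (auto simp: fork_closed_def low_pairs_def)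

lemma pairs_fork:
  assumes "fork_closed D" "(P, Q) \<in> low_pairs \<union> D" "P \<in> high_ends"
  shows "([2], Q) \<in> low_pairs \<union> D"
  using assms by (auto simp: fork_closed_def low_pairs_def low_ends_def high_ends_def)

lemma pairs_low:
  assumes "fork_closed D" "(P, Q) \<in> low_pairs \<union> D" "P' \<in> low_ends"
  shows "(P', Q) \<in> low_pairs"
  using pairs_ends[OF assms(1,2)] assms(3) by (auto simp: low_pairs_def)

lemma pairs_left:
  assumes "fork_closed D" "(P, Q) \<in> low_pairs \<union> D" "Q' \<in> low_ends"
  shows "(P, Q') \<in> low_pairs"
  using pairs_ends[OF assms(1,2)] assms(3) by (auto simp: low_pairs_def)

lemma caterpillars_dec_left:
  assumes D: "\<And>k. fork_closed (D k)"
    and PQ: "(P, Q) \<in> low_pairs \<union> D k" and P: "P = u @ Suc a # v"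
  shows "u @ a # v @ replicate k 0 @ rev Q \<in> caterpillars D"
proof -
  have "P \<in> low_ends \<union> high_ends" using pairs_ends[OF D PQ] by simp
  then consider "P = [1]" "u = []" "a = 0" "v = []" | "P = [2]" "u = []" "a = 1" "v = []"
    | "P = [3]" "u = []" "a = 2" "v = []" | "P = [0, 1]" "u = [0]" "a = 0" "v = []"
    using P[symmetric] by (auto simp: low_ends_def high_ends_def append_eq_Cons_conv)
  then show ?thesis
  proof cases
    case 1
    then show ?thesis
      using caterpillar_in_caterpillars[of "[0]" Q D k] pairs_low[OF D PQ]
      by (simp add: caterpillar_def low_ends_def)
  next
    case 2
    then show ?thesis
      using caterpillar_in_caterpillars[of "[1]" Q D k] pairs_low[OF D PQ]
      by (simp add: caterpillar_def low_ends_def)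
  next
    case 3
    then show ?thesis
      using caterpillar_in_caterpillars[of "[2]" Q D k] pairs_fork[OF D PQ]
      by (simp add: caterpillar_def high_ends_def)
  next
    \<comment> \<open>\<open>[0, 0]\<close> is the end \<open>[0]\<close> with the path longer by
      one.\<close>
    case 4
    then show ?thesis
      using caterpillar_in_caterpillars[of "[0]" Q D "Suc k"] pairs_low[OF D PQ, of "[0]"]
      by (simp add: caterpillar_def low_ends_def)
  qed
qed

lemma append_Cons_eq_append:
  assumes "u @ x # v = A @ B"
  obtains (left) v' where "A = u @ x # v'" "v = v' @ B" | (right) u' where "B = u' @ x # v" "u = A @ u'"
proof -
  have "(\<exists>v'. A = u @ x # v' \<and> v = v' @ B) \<or> (\<exists>u'. B = u' @ x # v \<and> u = A @ u')"
    using assms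
  proof (induction A arbitrary: u)
    case (Cons y A)
    then show ?case by (cases u) auto
  qed auto
  with that show thesis by blast
qed

text \<open>The path between the ends consists of zeros, so a positive letter lies in an end; a
  right end becomes a left end by reversal.\<close>

lemma caterpillars_dec:
  assumes D: "\<And>k. fork_closed (D k)" and w: "u @ Suc a # v \<in> caterpillars D"
  shows "u @ a # v \<in> caterpillars D"
  using w
proof (cases rule: caterpillars_cases)
  case (single b)
  then show ?thesis by (cases u) (auto intro: singleton_caterpillars)
next
  case (caterpillar k P Q)
  have eq: "u @ Suc a # v = P @ replicate k 0 @ rev Q"
    using caterpillar(2) by (simp add: caterpillar_def)
  then consider v' where "P = u @ Suc a # v'" "v = v' @ replicate k 0 @ rev Q"
    | u' where "rev Q = u' @ Suc a # v" "u = P @ replicate k 0 @ u'"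
    | "Suc a \<in> set (replicate k (0::nat))"
  proof (rule append_Cons_eq_append)
    fix u' assume u': "replicate k 0 @ rev Q = u' @ Suc a # v" "u = P @ u'"
    from u'(1)[symmetric] show thesis
      by (rule append_Cons_eq_append) (use u'(2) that(2,3) in \<open>auto intro: in_set_conv_decomp[THEN iffD2]\<close>)
  qed (rule that(1))
  then show ?thesis
  proof cases
    case 1
    then show ?thesis using caterpillars_dec_left[of D P Q k u a v'] D caterpillar(1) by simp
  next
    case 2
    then have "Q = rev v @ Suc a # rev u'" by (simp add: rev_swap)
    moreover have "(Q, P) \<in> low_pairs \<union> (D k)\<inverse>" using caterpillar(1) converse_low_pairs by blast
    ultimately have "rev v @ a # rev u' @ replicate k 0 @ rev P \<in> caterpillars (\<lambda>k. (D k)\<inverse>)"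
      using caterpillars_dec_left[of "\<lambda>k. (D k)\<inverse>" Q P k "rev v" a "rev u'"] D
      by (simp add: fork_closed_converse)
    then show ?thesis
      using rev_caterpillars_iff[of "u @ a # v" D] 2 by simp
  qed auto
qed

text \<open>A cut in the left end leaves one letter or \<open>[0, 2]\<close>; a cut in the path
  leaves the right end \<open>[1]\<close>; in the right end only \<open>[0, 1]\<close> can be cut,
  leaving \<open>[2]\<close>.\<close>

lemma caterpillars_cut_left:
  assumes D: "\<And>k. fork_closed (D k)" and w: "u @ a # b # v \<in> caterpillars D"
  shows "u @ [Suc a] \<in> caterpillars D"
  using w
proof (cases rule: caterpillars_cases)
  case (caterpillar k P Q)
  note PQ = caterpillar(1)
  have ends: "P \<in> low_ends \<union> high_ends" "Q \<in> low_ends \<union> high_ends"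
    using pairs_ends[OF D PQ] by simp_all
  have "u @ a # b # v = P @ replicate k 0 @ rev Q"
    using caterpillar(2) by (simp add: caterpillar_def)
  then consider s where "P = u @ a # s"
    | s t where "replicate k 0 = s @ a # t" "u = P @ s"
    | s where "rev Q = s @ a # b # v" "u = P @ replicate k 0 @ s"
  proof (rule append_Cons_eq_append)
    fix u' assume u': "replicate k 0 @ rev Q = u' @ a # b # v" "u = P @ u'"
    from u'(1)[symmetric] show thesis
      by (rule append_Cons_eq_append) (use u'(2) that(2,3) in auto)
  qed (rule that(1))
  then show ?thesis
  proof cases
    case 1
    then consider "u = []" "a \<le> 3" | "u = [0]" "a = 1"
      using ends(1) by (auto simp: low_ends_def high_ends_def append_eq_Cons_conv)
    then show ?thesis
    proof cases
      case 2
      have "([0], [2]) \<in> low_pairs" by (simp add: low_pairs_def low_ends_def high_ends_def)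
      then show ?thesis using caterpillar_in_caterpillars[of "[0]" "[2]" D 0] 2
        by (simp add: caterpillar_def numeral_2_eq_2)
    qed (auto intro: singleton_caterpillars)
  next
    case 2
    have "set (s @ a # t) \<subseteq> {0}" unfolding 2(1)[symmetric] by auto
    then have "a = 0" "replicate (length s) 0 = s"
      by (simp, intro replicate_length_same) auto
    then show ?thesis
      using caterpillar_in_caterpillars[of P "[1]" D "length s"] pairs_left[OF D PQ, of "[1]"] 2(2)
      by (simp add: caterpillar_def low_ends_def)
  next
    case 3
    then have Q: "Q = [0, 1]" "s = []" "a = 1"
      using ends(2) by (auto simp: low_ends_def high_ends_def Cons_eq_append_conv)
    then have u: "u = P @ replicate k 0" "a = 1" using 3(2) by auto
    have "(Q, P) \<in> low_pairs \<union> (D k)\<inverse>" using PQ converse_low_pairs by blast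
    then have "([2], P) \<in> low_pairs \<union> (D k)\<inverse>"
      using pairs_fork[of "(D k)\<inverse>" Q P] D Q by (simp add: fork_closed_converse high_ends_def)
    then have "(P, [2]) \<in> low_pairs \<union> D k" using converse_low_pairs by blast
    then show ?thesis
      using caterpillar_in_caterpillars[of P "[2]" D k] u by (simp add: caterpillar_def numeral_2_eq_2)
  qed
qed auto

lemma down_closed_caterpillars:
  assumes D: "\<And>k. fork_closed (D k)"
  shows "down_closed (caterpillars D)"
  unfolding down_closed_def
proof (intro conjI allI impI)
  show "[] \<notin> caterpillars D"
  proof
    assume "[] \<in> caterpillars D"
    then show False
    proof (cases rule: caterpillars_cases)
      case (caterpillar k P Q)
      then show False using pairs_ends[OF D caterpillar(1)]
        by (auto simp: caterpillar_def low_ends_def high_ends_def)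
    qed simp
  qed
  show "[0] \<in> caterpillars D" by (simp add: singleton_caterpillars)
next
  fix u a v assume "u @ Suc a # v \<in> caterpillars D"
  then show "u @ a # v \<in> caterpillars D" by (rule caterpillars_dec[OF D])
next
  fix u a b v assume w: "u @ a # b # v \<in> caterpillars D"
  then show "u @ [Suc a] \<in> caterpillars D" by (rule caterpillars_cut_left[OF D])
  have "rev v @ b # a # rev u \<in> caterpillars (\<lambda>k. (D k)\<inverse>)"
    using rev_caterpillars[OF w] by simp
  then have "rev v @ [Suc b] \<in> caterpillars (\<lambda>k. (D k)\<inverse>)"
    using caterpillars_cut_left[of "\<lambda>k. (D k)\<inverse>"] D by (metis fork_closed_converse)
  then show "Suc b # v \<in> caterpillars D"
    using rev_caterpillars_iff[of "Suc b # v" D] by simp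
qed

text \<open>The excluded triple gives the same word as \<open>(0, [0, 1], [0])\<close>.\<close>

lemma inj_caterpillar:
  "inj_on (\<lambda>(k, P, Q). caterpillar P k Q)
     ((UNIV \<times> (low_ends \<union> high_ends) \<times> (low_ends \<union> high_ends)) - {(0, [0], [0, 1])})"
proof -
  have left: "P = P'"
    if eq: "caterpillar P k Q = caterpillar P' k' Q'"
      and ends: "P \<in> low_ends \<union> high_ends" "P' \<in> low_ends \<union> high_ends"
        "Q \<in> low_ends \<union> high_ends" "Q' \<in> low_ends \<union> high_ends"
      and ne: "(k, P, Q) \<noteq> (0, [0], [0, 1])" "(k', P', Q') \<noteq> (0, [0], [0, 1])" for P k Q P' k' Q'
  proof (rule ccontr)
    assume "P \<noteq> P'"
    moreover have "hd P = hd P'"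
      using arg_cong[OF eq, of hd] ends(1,2)
      by (auto simp: caterpillar_def low_ends_def high_ends_def)
    ultimately have "P = [0] \<and> P' = [0, 1] \<or> P = [0, 1] \<and> P' = [0]"
      using ends(1,2) by (auto simp: low_ends_def high_ends_def)
    \<comment> \<open>Only \<open>[0]\<close> and \<open>[0, 1]\<close> share a first letter.
      Confusing them needs a rest that begins with 1 and goes on, which forces the excluded
      triple.\<close>
    moreover have no: False
      if "replicate k 0 @ rev Q = 1 # replicate k' 0 @ rev Q'" "(k, Q) \<noteq> (0, [0, 1])"
        "Q \<in> low_ends \<union> high_ends" "Q' \<in> low_ends \<union> high_ends" for k k' :: nat and Q Q'
      using that by (cases k; cases k') (auto simp: low_ends_def high_ends_def)
    ultimately show False
    proof (elim disjE conjE)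
      assume P: "P = [0]" "P' = [0, 1]"
      show False by (rule no[of k Q k' Q']) (use eq ends ne P in \<open>auto simp: caterpillar_def\<close>)
    next
      assume P: "P = [0, 1]" "P' = [0]"
      show False by (rule no[of k' Q' k Q]) (use eq ends ne P in \<open>auto simp: caterpillar_def\<close>)
    qed
  qed
  show ?thesis
  proof (rule inj_onI)
    fix x y
    assume x: "x \<in> (UNIV \<times> (low_ends \<union> high_ends) \<times> (low_ends \<union> high_ends)) - {(0, [0], [0, 1])}"
      and y: "y \<in> (UNIV \<times> (low_ends \<union> high_ends) \<times> (low_ends \<union> high_ends)) - {(0, [0], [0, 1])}"
      and xy: "(\<lambda>(k, P, Q). caterpillar P k Q) x = (\<lambda>(k, P, Q). caterpillar P k Q) y"
    obtain k P Q k' P' Q' where def: "x = (k, P, Q)" "y = (k', P', Q')"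
      by (metis prod_cases3)
    have eq: "caterpillar P k Q = caterpillar P' k' Q'" using xy def by simp
    have ends: "P \<in> low_ends \<union> high_ends" "P' \<in> low_ends \<union> high_ends"
        "Q \<in> low_ends \<union> high_ends" "Q' \<in> low_ends \<union> high_ends"
      and ne: "(k, P, Q) \<noteq> (0, [0], [0, 1])" "(k', P', Q') \<noteq> (0, [0], [0, 1])"
      using x y unfolding def by blast+
    have P: "P = P'" by (rule left[OF eq ends ne])
    then have eq': "replicate k 0 @ rev Q = replicate k' 0 @ rev Q'"
      using eq by (simp add: caterpillar_def)
    have "Q \<noteq> []" "Q' \<noteq> []" using ends(3,4) by (auto simp: low_ends_def high_ends_def)
    \<comment> \<open>The last letter gives \<open>hd Q\<close>; the set of letters, with 0 added to
      hide the path, tells \<open>[0]\<close> from \<open>[0, 1]\<close>.\<close>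
    then have "hd Q = hd Q'" using arg_cong[OF eq', of last] by (simp add: last_rev)
    moreover have "insert 0 (set (replicate k 0 @ rev Q)) = insert 0 (set Q)"
      for k and Q :: "nat list" by auto
    then have "insert 0 (set Q) = insert 0 (set Q')" using eq' by metis
    ultimately have "Q = Q'"
      using ends(3,4) unfolding low_ends_def high_ends_def Un_iff insert_iff empty_iff
      by (elim disjE) (simp_all only: list.sel list.set, simp_all)
    moreover from this have "k = k'" using arg_cong[OF eq', of length] by simp
    ultimately show "x = y" using P def by simp
  qed
qed

section \<open>Weights of the ends and of the whole family\<close>

definition end_weight :: "nat list \<Rightarrow> nat" where
  "end_weight P = 2 * length P + sum_list P"

text \<open>Every initial segment of this list satisfies \<open>fork_closed\<close>, and every pair after the
  first adds at most \<open>z\<close> to \<open>fork_sum z\<close>.\<close>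

definition fork_pairs :: "(nat list \<times> nat list) list" where
  "fork_pairs = [([2], [2]), ([3], [2]), ([2], [3]), ([3], [3]), ([0, 1], [2]), ([0, 1], [3]),
     ([2], [0, 1]), ([3], [0, 1]), ([0, 1], [0, 1])]"

definition forks :: "nat \<Rightarrow> (nat list \<times> nat list) set" where
  "forks n = set (take n fork_pairs)"

text \<open>Each fork has weight at least 4, so a factor \<open>z ^ 8\<close> is split off.\<close>

definition fork_sum :: "real \<Rightarrow> nat \<Rightarrow> real" where
  "fork_sum z n = (\<Sum>(P, Q)\<in>forks n. z ^ (end_weight P + end_weight Q - 8))"

lemma fork_sum_eq: "fork_sum z n = sum_list (take n [1, z, z, z\<^sup>2, z, z\<^sup>2, z, z\<^sup>2, z\<^sup>2])"
proof -
  have "distinct fork_pairs" by (simp add: fork_pairs_def)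
  then have "distinct (take n fork_pairs)" by simp
  then have "fork_sum z n =
      sum_list (map (\<lambda>(P, Q). z ^ (end_weight P + end_weight Q - 8)) (take n fork_pairs))"
    unfolding fork_sum_def forks_def by (rule sum_list_distinct_conv_sum_set[symmetric])
  also have "\<dots> = sum_list (take n (map (\<lambda>(P, Q). z ^ (end_weight P + end_weight Q - 8)) fork_pairs))"
    by (simp add: take_map)
  also have "map (\<lambda>(P, Q). z ^ (end_weight P + end_weight Q - 8)) fork_pairs =
      [1, z, z, z\<^sup>2, z, z\<^sup>2, z, z\<^sup>2, z\<^sup>2]"
    by (simp add: fork_pairs_def end_weight_def power2_eq_square)
  finally show ?thesis .
qed

lemma forks_subset: "forks n \<subseteq> high_ends \<times> high_ends"
proof -
  have "set fork_pairs \<subseteq> high_ends \<times> high_ends"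
    by (simp add: fork_pairs_def high_ends_def)
  then show ?thesis unfolding forks_def by (meson order_trans set_take_subset)
qed

lemma fork_closed_forks: "fork_closed (forks n)"
proof -
  consider "n = 0" | "n = 1" | "n = 2" | "n = 3" | "n = 4" | "n = 5" | "n = 6" | "n = 7" | "n = 8"
    | "n \<ge> 9" by linarith
  then have "\<forall>(P, Q)\<in>forks n. ([2], Q) \<in> forks n \<and> (P, [2]) \<in> forks n"
    by cases (simp_all add: forks_def fork_pairs_def)
  then show ?thesis using forks_subset by (simp add: fork_closed_def)
qed

lemma word_weight_caterpillar:
  "word_weight (caterpillar P k Q) = 2 * k + end_weight P + end_weight Q - 1"
  by (simp add: word_weight_def caterpillar_def end_weight_def sum_list_replicate)

lemma end_weight_ge: "P \<in> low_ends \<union> high_ends \<Longrightarrow> 2 \<le> end_weight P"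
  "P \<in> high_ends \<Longrightarrow> 4 \<le> end_weight P"
  by (auto simp: low_ends_def high_ends_def end_weight_def)

lemma low_pairs_sum:
  assumes "z \<noteq> (0 :: real)"
  shows "(\<Sum>(P, Q)\<in>low_pairs. z ^ (end_weight P + end_weight Q - 1)) =
    z ^ 3 * (1 + z) * (1 + z + 2 * z\<^sup>2 + 4 * z ^ 3)"
proof -
  \<comment> \<open>Generating functions of the ends without and with a fork; the division by
    \<open>z\<close> below accounts for the \<open>- 1\<close> in the weight.\<close>
  define l h where "l = z\<^sup>2 + z ^ 3" and "h = z ^ 4 + 2 * z ^ 5"
  have sums: "(\<Sum>P\<in>low_ends. z ^ end_weight P) = l" "(\<Sum>P\<in>high_ends. z ^ end_weight P) = h"
    by (simp_all add: low_ends_def high_ends_def end_weight_def l_def h_def)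
  have disj: "low_ends \<inter> high_ends = {}" by (simp add: low_ends_def high_ends_def)
  have fin: "finite low_ends" "finite high_ends" by (simp_all add: low_ends_def high_ends_def)
  have sum_all: "(\<Sum>P\<in>low_ends \<union> high_ends. z ^ end_weight P) = l + h"
    by (simp add: sum.union_disjoint fin disj sums)
  have "(\<Sum>(P, Q)\<in>low_pairs. z ^ (end_weight P + end_weight Q - 1)) =
      (\<Sum>(P, Q)\<in>low_pairs. z ^ end_weight P * z ^ end_weight Q / z)"
  proof (rule sum.cong[OF refl], clarify)
    fix P Q assume "(P, Q) \<in> low_pairs"
    then have "2 \<le> end_weight P" using end_weight_ge(1)[of P] by (auto simp: low_pairs_def)
    then show "z ^ (end_weight P + end_weight Q - 1) = z ^ end_weight P * z ^ end_weight Q / z"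
      using assms by (simp add: power_diff flip: power_add)
  qed
  also have "\<dots> = (\<Sum>(P, Q)\<in>low_ends \<times> (low_ends \<union> high_ends). z ^ end_weight P * z ^ end_weight Q / z) +
      (\<Sum>(P, Q)\<in>high_ends \<times> low_ends. z ^ end_weight P * z ^ end_weight Q / z)"
    unfolding low_pairs_def by (rule sum.union_disjoint) (use fin disj in auto)
  also have "\<dots> = (l * (l + h) + h * l) / z"
    by (simp add: sums sum_all add_divide_distrib
        flip: sum.cartesian_product sum_divide_distrib sum_distrib_left sum_distrib_right)
  also have "\<dots> = z ^ 3 * (1 + z) * (1 + z + 2 * z\<^sup>2 + 4 * z ^ 3)"
    using assms by (simp add: l_def h_def field_simps power2_eq_square power3_eq_cube eval_nat_numeral)
  finally show ?thesis .
qed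

text \<open>The pairs in \<open>low_pairs\<close> give a geometric series of ratio
  \<open>z\<^sup>2\<close>, the pairs of forks give \<open>z ^ 7 * R\<close>, and the one-letter
  words are added separately.\<close>

lemma has_sum_caterpillars:
  assumes z: "0 < z" "z < 1" and t: "(\<lambda>k. z ^ (2 * k) * fork_sum z (t k)) sums R"
  shows "((\<lambda>w. z ^ word_weight w) has_sum
    ((z + z ^ 3 + z ^ 4 + 2 * z ^ 5 + 2 * z ^ 6 + z ^ 7) / (1 - z) + z ^ 7 * R))
    (caterpillars (\<lambda>k. forks (t k)))"
proof -
  define f where "f = (\<lambda>(k, P, Q). z ^ (2 * k + end_weight P + end_weight Q - 1))"
  define c where "c = (\<lambda>(k, P, Q). caterpillar P k Q)"
  define J where "J = (SIGMA k:UNIV. low_pairs \<union> forks (t k))"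
  define L where "L = z ^ 3 * (1 + z) * (1 + z + 2 * z\<^sup>2 + 4 * z ^ 3)"
  define T where "T = L * (1 / (1 - z\<^sup>2)) + z ^ 7 * R"
  have fin: "finite low_pairs" "finite (forks n)" for n
    by (simp_all add: low_pairs_def low_ends_def high_ends_def forks_def)
  have disj: "low_pairs \<inter> forks n = {}" for n
    using forks_subset[of n] by (auto simp: low_pairs_def low_ends_def high_ends_def)
  have inner: "((\<lambda>p. f (k, p)) has_sum z ^ (2 * k) * L + z ^ 7 * (z ^ (2 * k) * fork_sum z (t k)))
      (low_pairs \<union> forks (t k))" for k
  proof (rule has_sum_finiteI)
    have low: "(\<Sum>p\<in>low_pairs. f (k, p)) = z ^ (2 * k) * L"
      unfolding L_def low_pairs_sum[of z, symmetric, OF less_imp_neq[OF z(1), symmetric]] sum_distrib_left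
    proof (rule sum.cong[OF refl], clarify)
      fix P Q assume "(P, Q) \<in> low_pairs"
      then have "2 \<le> end_weight P" using end_weight_ge(1)[of P] by (auto simp: low_pairs_def)
      then show "f (k, P, Q) = z ^ (2 * k) * z ^ (end_weight P + end_weight Q - 1)"
        by (simp add: f_def add.assoc flip: power_add)
    qed
    have high: "(\<Sum>p\<in>forks (t k). f (k, p)) = z ^ 7 * (z ^ (2 * k) * fork_sum z (t k))"
      unfolding fork_sum_def sum_distrib_left
    proof (rule sum.cong[OF refl], clarify)
      fix P Q assume "(P, Q) \<in> forks (t k)"
      then have "4 \<le> end_weight P" "4 \<le> end_weight Q"
        using forks_subset end_weight_ge(2) by blast+
      then have "2 * k + end_weight P + end_weight Q - 1 =
          7 + (2 * k + (end_weight P + end_weight Q - 8))" by simp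
      then show "f (k, P, Q) = z ^ 7 * (z ^ (2 * k) * z ^ (end_weight P + end_weight Q - 8))"
        by (simp add: f_def flip: power_add)
    qed
    show "z ^ (2 * k) * L + z ^ 7 * (z ^ (2 * k) * fork_sum z (t k)) =
        (\<Sum>p\<in>low_pairs \<union> forks (t k). f (k, p))"
      using fin disj by (simp add: sum.union_disjoint low high)
  qed (use fin in simp)
  have fork_nonneg: "0 \<le> fork_sum z n" for n
    unfolding fork_sum_def using z by (intro sum_nonneg) auto
  have L: "L \<ge> 0" using z by (simp add: L_def)
  have "(\<lambda>k. (z\<^sup>2) ^ k) sums (1 / (1 - z\<^sup>2))"
    using z by (intro geometric_sums) (simp add: abs_square_less_1)
  then have "(\<lambda>k. z ^ (2 * k)) sums (1 / (1 - z\<^sup>2))" by (simp add: power_mult)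
  then have "(\<lambda>k. z ^ (2 * k) * L + z ^ 7 * (z ^ (2 * k) * fork_sum z (t k))) sums T"
    unfolding T_def using t by (subst mult.commute[of L]) (intro sums_add sums_mult sums_mult2)
  then have outer: "((\<lambda>k. z ^ (2 * k) * L + z ^ 7 * (z ^ (2 * k) * fork_sum z (t k))) has_sum T) UNIV"
    using z L fork_nonneg by (intro sums_nonneg_imp_has_sum) auto
  have "f summable_on (SIGMA k:UNIV. low_pairs \<union> forks (t k))"
    by (rule summable_on_SigmaI[OF inner has_sum_imp_summable[OF outer]]) (use z in \<open>auto simp: f_def\<close>)
  then have "(f has_sum infsum f J) (SIGMA k:UNIV. low_pairs \<union> forks (t k))"
    unfolding J_def by simp
  from has_sum_Sigma'[OF this inner] have "infsum f J = T"
    using outer by (rule has_sum_unique)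
  with \<open>(f has_sum infsum f J) _\<close> have J: "(f has_sum T) J" by (simp add: J_def)
  have mem: "(0, [0], [0, 1]) \<in> J" "(0, [0, 1], [0]) \<in> J - {(0, [0], [0, 1])}"
    by (simp_all add: J_def low_pairs_def low_ends_def high_ends_def)
  \<comment> \<open>The word \<open>[0, 1, 0]\<close>, of weight 6, was counted twice.\<close>
  have "(f has_sum T - z ^ 6) (J - {(0, [0], [0, 1])})"
    by (rule has_sum_Diff[OF J]) (use mem in \<open>auto intro!: has_sum_finiteI simp: f_def end_weight_def eval_nat_numeral\<close>)
  moreover have "f = (\<lambda>w. z ^ word_weight w) \<circ> c"
    by (auto simp: f_def c_def word_weight_caterpillar)
  moreover have "inj_on c (J - {(0, [0], [0, 1])})"
    unfolding c_def
    by (rule inj_on_subset[OF inj_caterpillar])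
      (use forks_subset in \<open>auto simp: J_def low_pairs_def\<close>)
  moreover have "c ` (J - {(0, [0], [0, 1])}) = c ` J"
  proof -
    have "c (0, [0], [0, 1]) = c (0, [0, 1], [0])" by (simp add: c_def caterpillar_def)
    then have "c (0, [0], [0, 1]) \<in> c ` (J - {(0, [0], [0, 1])})" using mem(2) by auto
    then show ?thesis by auto
  qed
  ultimately have c: "((\<lambda>w. z ^ word_weight w) has_sum T - z ^ 6) (c ` J)"
    by (metis has_sum_reindex)
  have "(\<Sum>w\<in>(\<lambda>a. [a]) ` {..4::nat}. z ^ word_weight w) = (\<Sum>a\<le>4. z ^ Suc a)"
    by (subst sum.reindex) (auto simp: inj_on_def word_weight_def)
  then have singles: "((\<lambda>w. z ^ word_weight w) has_sum (z + z\<^sup>2 + z ^ 3 + z ^ 4 + z ^ 5))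
      ((\<lambda>a. [a]) ` {..4})"
    by (intro has_sum_finiteI) (simp_all add: eval_nat_numeral)
  have length_c: "length (c x) \<ge> 2" if "x \<in> J" for x
    using that forks_subset
    by (force simp: J_def c_def caterpillar_def low_pairs_def low_ends_def high_ends_def)
  have "(\<lambda>a. [a]) ` {..4} \<inter> c ` J = {}"
  proof (rule equals0I)
    fix w assume "w \<in> (\<lambda>a. [a]) ` {..4} \<inter> c ` J"
    then obtain a x where "x \<in> J" "c x = [a]" by (metis IntE imageE)
    then show False using length_c[of x] by simp
  qed
  from has_sum_Un_disjoint[OF singles c this]
  have "((\<lambda>w. z ^ word_weight w) has_sum (z + z\<^sup>2 + z ^ 3 + z ^ 4 + z ^ 5 + (T - z ^ 6)))
      (caterpillars (\<lambda>k. forks (t k)))"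
    by (simp add: caterpillars_def J_def c_def)
  moreover have "z + z\<^sup>2 + z ^ 3 + z ^ 4 + z ^ 5 + (T - z ^ 6) =
      (z + z ^ 3 + z ^ 4 + 2 * z ^ 5 + 2 * z ^ 6 + z ^ 7) / (1 - z) + z ^ 7 * R"
  proof -
    have "1 - z\<^sup>2 = (1 + z) * (1 - z)" by (simp add: power2_eq_square algebra_simps)
    then have "L * (1 / (1 - z\<^sup>2)) = z ^ 3 * (1 + z + 2 * z\<^sup>2 + 4 * z ^ 3) / (1 - z)"
      using z by (simp add: L_def)
    moreover have "z + z\<^sup>2 + z ^ 3 + z ^ 4 + z ^ 5 +
        z ^ 3 * (1 + z + 2 * z\<^sup>2 + 4 * z ^ 3) / (1 - z) - z ^ 6 =
        (z + z ^ 3 + z ^ 4 + 2 * z ^ 5 + 2 * z ^ 6 + z ^ 7) / (1 - z)"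
      using z by (simp add: field_simps eval_nat_numeral)
    ultimately show ?thesis unfolding T_def by linarith
  qed
  ultimately show ?thesis by simp
qed

section \<open>Expansions with prescribed digits\<close>

text \<open>Greedy choice: the remainder never leaves the interval between the two extreme
  expansions, because no gap between consecutive digits exceeds \<open>q\<close> times its
  length.\<close>

lemma digit_expansion:
  fixes q r :: real and v :: "nat \<Rightarrow> real"
  assumes q: "0 < q" "q < 1"
    and gap: "\<And>i. i < m \<Longrightarrow> v (Suc i) - v i \<le> q * (v m - v 0) / (1 - q)"
    and r: "v 0 / (1 - q) \<le> r" "r \<le> v m / (1 - q)"
  shows "\<exists>t. (\<forall>k. t k \<le> m) \<and> (\<lambda>k. q ^ k * v (t k)) sums r"
proof -
  \<comment> \<open>The values of the expansions with all digits \<open>v 0\<close> and all digits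
    \<open>v m\<close>.\<close>
  define A B where "A = v 0 / (1 - q)" and "B = v m / (1 - q)"
  have AB: "v 0 + q * A = A" "v m + q * B = B" "q * (v m - v 0) / (1 - q) = q * B - q * A"
    using q by (simp add: A_def field_simps, simp add: B_def field_simps,
        simp add: A_def B_def diff_divide_distrib right_diff_distrib)
  have "\<exists>i\<le>m. (x - v i) / q \<in> {A..B}" if x: "x \<in> {A..B}" for x
  proof -
    define I where "I = {i. i \<le> m \<and> v i + q * A \<le> x}"
    have "finite I" "0 \<in> I" using x AB by (auto simp: I_def)
    define i where "i = Max I"
    have i: "i \<in> I" unfolding i_def using \<open>finite I\<close> \<open>0 \<in> I\<close> by (intro Max_in) auto
    have "x \<le> v i + q * B"
    proof (cases "i = m")
      case True
      then show ?thesis using AB x by simp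
    next
      case False
      then have "i < m" using i by (simp add: I_def)
      moreover have "Suc i \<notin> I" using Max_ge[OF \<open>finite I\<close>, of "Suc i"] by (auto simp: i_def)
      ultimately show ?thesis using gap[of i] AB by (auto simp: I_def)
    qed
    then show ?thesis using i q by (intro exI[of _ i]) (auto simp: I_def field_simps)
  qed
  then obtain d where d: "d x \<le> m" "(x - v (d x)) / q \<in> {A..B}" if "x \<in> {A..B}" for x
    by metis
  define s where "s = rec_nat r (\<lambda>_ x. (x - v (d x)) / q)"
  have s0: "s 0 = r" and sSuc: "s (Suc k) = (s k - v (d (s k))) / q" for k
    by (simp_all add: s_def)
  have s: "s k \<in> {A..B}" for k
  proof (induction k)
    case 0
    then show ?case using r by (simp add: s0 A_def B_def)
  next
    case (Suc k)
    then show ?case using d(2) by (simp add: sSuc)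
  qed
  have partial: "(\<Sum>k<n. q ^ k * v (d (s k))) = r - q ^ n * s n" for n
  proof (induction n)
    case (Suc n)
    have "q ^ Suc n * s (Suc n) = q ^ n * s n - q ^ n * v (d (s n))"
      using q by (simp add: sSuc field_simps)
    then show ?case using Suc by simp
  qed (simp add: s0)
  have "(\<lambda>n. q ^ n * s n) \<longlonglongrightarrow> 0"
  proof (rule tendsto_0_le)
    show "(\<lambda>n. q ^ n) \<longlonglongrightarrow> 0" using q by (intro LIMSEQ_power_zero) simp
    have "norm (q ^ n * s n) \<le> norm (q ^ n) * max \<bar>A\<bar> \<bar>B\<bar>" for n
    proof -
      have "\<bar>s n\<bar> \<le> max \<bar>A\<bar> \<bar>B\<bar>" using s[of n] by (auto simp: max_def abs_if)
      then show ?thesis using q by (simp add: abs_mult mult_left_mono)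
    qed
    then show "\<forall>\<^sub>F n in sequentially. norm (q ^ n * s n) \<le> norm (q ^ n) * max \<bar>A\<bar> \<bar>B\<bar>"
      by simp
  qed
  then have "(\<lambda>n. r - q ^ n * s n) \<longlonglongrightarrow> r - 0" by (intro tendsto_diff tendsto_const)
  then have "(\<lambda>k. q ^ k * v (d (s k))) sums r" by (simp add: sums_def partial)
  then show ?thesis using d(1) s by (intro exI[of _ "\<lambda>k. d (s k)"]) auto
qed

section \<open>Choosing the growth rate\<close>

text \<open>Divided by \<open>1 - z\<^sup>2\<close>, with \<open>z = 1 / \<gamma>\<close>,
  \<open>eq\<close> says that the weights add up to 1 once the forks at distances from
  \<open>N\<close> on contribute \<open>u / (1 - z\<^sup>2)\<close> in digits.\<close>

lemma growth_rate_caterpillars: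
  fixes \<gamma> :: real and N :: nat
  assumes \<gamma>: "2 < \<gamma>" "\<gamma> < 5 / 2"
    and u: "1 \<le> u" "u \<le> 2"
    and eq: "(1 + 1 / \<gamma>) * (1 - 2 * (1 / \<gamma>) - (1 / \<gamma>) ^ 3 - (1 / \<gamma>) ^ 4 - 2 * (1 / \<gamma>) ^ 5 -
      2 * (1 / \<gamma>) ^ 6 - (1 / \<gamma>) ^ 7) = u * (1 / \<gamma>) ^ (2 * N + 7)"
  shows "\<exists>C. perm_class C \<and> growth_rate C \<gamma>"
proof -
  define z where "z = 1 / \<gamma>"
  have z: "2 / 5 < z" "z < 1 / 2" using \<gamma> by (simp_all add: z_def field_simps)
  define q where "q = z\<^sup>2"
  have q: "0 < q" "q < 1" using z by (simp_all add: q_def power_less_one_iff)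
  \<comment> \<open>The empty choice of forks is not a digit: the step from 0 to 1 can exceed the
    gap bound.\<close>
  define v where "v i = fork_sum z (Suc i)" for i
  have vals: "v 0 = 1" "v 8 = 1 + 4 * z + 4 * z\<^sup>2"
    by (simp_all add: v_def fork_sum_eq)
  have gap_le: "z \<le> q * (v 8 - v 0) / (1 - q)"
  proof -
    \<comment> \<open>Here \<open>\<gamma> < 5 / 2\<close> enters: \<open>4 * z\<^sup>2\<close> is
      at least \<open>16 / 25\<close>, more than \<open>1 - z\<close>, and multiplying by
      \<open>z * (1 + z)\<close> gives the bound for the largest step, \<open>z\<close>.\<close>
    have "(2 / 5) * (2 / 5) \<le> z * z" using z by (intro mult_mono) auto
    then have "1 - z \<le> 4 * z\<^sup>2" using z by (simp add: power2_eq_square)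
    then have "(1 - z) * (z * (1 + z)) \<le> 4 * z\<^sup>2 * (z * (1 + z))"
      using z by (intro mult_right_mono) auto
    then have "z * (1 - q) \<le> q * (v 8 - v 0)"
      by (simp add: q_def vals power2_eq_square algebra_simps)
    then show ?thesis using q by (simp add: field_simps)
  qed
  have "v (Suc i) - v i \<le> q * (v 8 - v 0) / (1 - q)" if "i < 8" for i
  proof -
    have "z\<^sup>2 \<le> z" using z by (simp add: power2_eq_square)
    moreover have "v (Suc i) - v i \<in> {z, z\<^sup>2}"
    proof -
      have "i = 0 \<or> i = 1 \<or> i = 2 \<or> i = 3 \<or> i = 4 \<or> i = 5 \<or> i = 6 \<or> i = 7"
        using that by arith
      then show ?thesis by (elim disjE) (simp_all add: v_def fork_sum_eq)
    qed
    ultimately show ?thesis using gap_le by auto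
  qed
  moreover have "v 0 / (1 - q) \<le> u / (1 - q)"
    using u q by (intro divide_right_mono) (auto simp: vals)
  moreover have "u / (1 - q) \<le> v 8 / (1 - q)"
  proof (intro divide_right_mono)
    show "u \<le> v 8" using u(2) z(1) zero_le_power2[of z] unfolding vals by linarith
  qed (use q in simp)
  ultimately obtain t where t: "\<forall>k. t k \<le> 8" "(\<lambda>k. q ^ k * v (t k)) sums (u / (1 - q))"
    using digit_expansion[OF q] by blast
  define t' where "t' k = (if k < N then 0 else Suc (t (k - N)))" for k
  have "(\<lambda>k. z ^ (2 * (k + N)) * fork_sum z (t' (k + N))) sums (z ^ (2 * N) * (u / (1 - q)))"
  proof -
    have "z ^ (2 * (k + N)) = z ^ (2 * N) * q ^ k" for k
      by (simp add: q_def ac_simps flip: power_mult power_add)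
    then show ?thesis
      using sums_mult[OF t(2), of "z ^ (2 * N)"] by (simp add: t'_def v_def mult_ac)
  qed
  moreover have "(\<Sum>k<N. z ^ (2 * k) * fork_sum z (t' k)) = 0"
    by (intro sum.neutral) (simp add: t'_def fork_sum_eq)
  ultimately have "(\<lambda>k. z ^ (2 * k) * fork_sum z (t' k)) sums (z ^ (2 * N) * (u / (1 - q)))"
    using sums_iff_shift[of "\<lambda>k. z ^ (2 * k) * fork_sum z (t' k)" N] by simp
  from has_sum_caterpillars[OF _ _ this]
  have "((\<lambda>w. z ^ word_weight w) has_sum
      ((z + z ^ 3 + z ^ 4 + 2 * z ^ 5 + 2 * z ^ 6 + z ^ 7) / (1 - z) +
        z ^ 7 * (z ^ (2 * N) * (u / (1 - q)))))
      (caterpillars (\<lambda>k. forks (t' k)))"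
    using z by simp
  moreover have "(z + z ^ 3 + z ^ 4 + 2 * z ^ 5 + 2 * z ^ 6 + z ^ 7) / (1 - z) +
        z ^ 7 * (z ^ (2 * N) * (u / (1 - q))) = 1"
  proof -
    have q': "1 - q = (1 + z) * (1 - z)" by (simp add: q_def power2_eq_square algebra_simps)
    have "z ^ 7 * (z ^ (2 * N) * (u / (1 - q))) = u * z ^ (2 * N + 7) / (1 - q)"
      by (simp add: power_add)
    also have "\<dots> = (1 + z) * (1 - 2 * z - z ^ 3 - z ^ 4 - 2 * z ^ 5 - 2 * z ^ 6 - z ^ 7) /
        ((1 + z) * (1 - z))"
      by (simp only: eq[folded z_def] q')
    also have "\<dots> = (1 - 2 * z - z ^ 3 - z ^ 4 - 2 * z ^ 5 - 2 * z ^ 6 - z ^ 7) / (1 - z)"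
      using z by simp
    finally show ?thesis using z by (simp add: field_simps)
  qed
  ultimately have sum: "((\<lambda>w. (1 / \<gamma>) ^ word_weight w) has_sum 1) (caterpillars (\<lambda>k. forks (t' k)))"
    by (simp add: z_def)
  have closed: "down_closed (caterpillars (\<lambda>k. forks (t' k)))"
    by (intro down_closed_caterpillars fork_closed_forks)
  show ?thesis
    using perm_class_sum_codes[OF closed] growth_rate_sum_codes[OF closed _ sum] \<gamma> by auto
qed

lemma root_bounds:
  fixes x :: real
  assumes "x ^ 7 - 2 * x ^ 6 - x ^ 4 - x ^ 3 - 2 * x ^ 2 - 2 * x - 1 = 0"
  shows "2 < x" "x < 12 / 5"
proof -
  have eq: "x ^ 6 * (x - 2) = x ^ 4 + x ^ 3 + 2 * x ^ 2 + 2 * x + 1"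
    using assms by (simp add: algebra_simps eval_nat_numeral)
  \<comment> \<open>Completing squares shows positivity for every real \<open>x\<close>, negative
    ones included.\<close>
  have "x ^ 4 + x ^ 3 + 2 * x ^ 2 + 2 * x + 1 =
      (x ^ 2 + x / 2) ^ 2 + (7 / 4) * (x + 4 / 7) ^ 2 + 3 / 7"
    by (simp add: field_simps eval_nat_numeral)
  also have "\<dots> > 0" by (intro add_nonneg_pos add_nonneg_nonneg) auto
  finally have "x ^ 6 * (x - 2) > 0" by (simp add: eq)
  then show "2 < x" by (simp add: zero_less_mult_iff)
  show "x < 12 / 5"
  proof (rule ccontr)
    assume "\<not> x < 12 / 5"
    then have x: "x \<ge> 12 / 5" by simp
    have x2: "12 / 5 * x \<le> x ^ 2" using x by (simp add: power2_eq_square)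
    have x3: "12 / 5 * x ^ 2 \<le> x ^ 3" using x by (simp add: power2_eq_square power3_eq_cube)
    have x4: "12 / 5 * x ^ 3 \<le> x ^ 4" using x by (simp add: eval_nat_numeral)
    \<comment> \<open>The factor is 2.304, while for \<open>x \<ge> 12 / 5\<close> the right side of
      \<open>eq\<close> stays below \<open>2 * x ^ 4\<close>.\<close>
    have "144 / 25 * (2 / 5) \<le> x ^ 2 * (x - 2)" using x x2 by (intro mult_mono) auto
    then have "x ^ 4 * (144 / 25 * (2 / 5)) \<le> x ^ 4 * (x ^ 2 * (x - 2))"
      by (intro mult_left_mono) auto
    also have "\<dots> = x ^ 4 + x ^ 3 + 2 * x ^ 2 + 2 * x + 1"
      unfolding eq[symmetric] by (simp add: eval_nat_numeral)
    finally show False using x x2 x3 x4 by simp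
  qed
qed

theorem theorem1:
  fixes \<theta>B :: real
  assumes "\<theta>B ^ 7 - 2 * \<theta>B ^ 6 - \<theta>B ^ 4 - \<theta>B ^ 3 - 2 * \<theta>B ^ 2 - 2 * \<theta>B - 1 = 0"
  shows "\<forall>\<epsilon>>0. \<exists>\<delta>1 \<delta>2. 0 < \<delta>1 \<and> \<delta>1 < \<delta>2 \<and> \<delta>2 < \<epsilon> \<and>
           (\<forall>\<gamma>\<in>{\<theta>B + \<delta>1 .. \<theta>B + \<delta>2}. \<exists>C. perm_class C \<and> growth_rate C \<gamma>)"
proof (intro allI impI)
  fix \<epsilon> :: real
  assume \<epsilon>: "\<epsilon> > 0"
  \<comment> \<open>The reversed polynomial; its zero \<open>1 / \<theta>B\<close> belongs to the
    family without pairs of forks.\<close>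
  define P where "P z = 1 - 2 * z - z ^ 3 - z ^ 4 - 2 * z ^ 5 - 2 * z ^ 6 - z ^ 7" for z :: real
  have \<theta>: "2 < \<theta>B" "\<theta>B < 12 / 5" using root_bounds[OF assms] by simp_all
  have pow: "\<theta>B ^ 7 * (1 / \<theta>B) ^ k = \<theta>B ^ (7 - k)" if "k \<le> 7" for k
    using that \<theta> by (simp add: power_diff power_one_over)
  have "\<theta>B ^ 7 * P (1 / \<theta>B) = \<theta>B ^ 7 - 2 * (\<theta>B ^ 7 * (1 / \<theta>B) ^ 1) - \<theta>B ^ 7 * (1 / \<theta>B) ^ 3 -
      \<theta>B ^ 7 * (1 / \<theta>B) ^ 4 - 2 * (\<theta>B ^ 7 * (1 / \<theta>B) ^ 5) - 2 * (\<theta>B ^ 7 * (1 / \<theta>B) ^ 6) -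
      \<theta>B ^ 7 * (1 / \<theta>B) ^ 7"
    by (simp add: P_def right_diff_distrib)
  also have "\<dots> = 0" using assms by (simp only: pow) simp
  finally have "\<theta>B ^ 7 * P (1 / \<theta>B) = 0" .
  then have P0: "P (1 / \<theta>B) = 0" using \<theta> by simp
  \<comment> \<open>The summand \<open>1 / 20\<close> keeps \<open>b\<close> below
    \<open>5 / 2\<close>, as \<open>\<theta>B < 12 / 5\<close>.\<close>
  define b where "b = \<theta>B + min (\<epsilon> / 2) (1 / 20)"
  have b: "\<theta>B < b" "b < \<theta>B + \<epsilon>" "b < 5 / 2" using \<epsilon> \<theta> by (auto simp: b_def min_def)
  have "P (1 / \<theta>B) < P (1 / b)"
  proof -
    have z: "0 < 1 / b" "1 / b < 1 / \<theta>B" using b \<theta> by (simp_all add: field_simps)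
    have "(1 / b) ^ n \<le> (1 / \<theta>B) ^ n" for n using z by (intro power_mono) auto
    from this[of 3] this[of 4] this[of 5] this[of 6] this[of 7] z(2)
    show ?thesis unfolding P_def by linarith
  qed
  then have Pb: "P (1 / b) > 0" using P0 by simp
  have "(\<lambda>n. (1 / b) ^ n) \<longlonglongrightarrow> 0" using b \<theta> by (intro LIMSEQ_power_zero) (simp add: field_simps)
  then have "\<forall>\<^sub>F n in sequentially. (1 / b) ^ n < (1 + 1 / b) * P (1 / b) / 2"
    using Pb b \<theta> by (intro order_tendstoD(2)[of _ 0]) (auto simp: add_pos_pos)
  then obtain M where M: "\<And>n. n \<ge> M \<Longrightarrow> (1 / b) ^ n < (1 + 1 / b) * P (1 / b) / 2"
    by (auto simp: eventually_sequentially)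
  \<comment> \<open>The number that the digits must represent for growth rate \<open>x\<close>. It
    is 0 at \<open>\<theta>B\<close> and, by the choice of \<open>M\<close>, exceeds 2 at
    \<open>b\<close>.\<close>
  define u where "u x = (1 + 1 / x) * P (1 / x) / (1 / x) ^ (2 * M + 7)" for x
  have cont: "continuous_on {\<theta>B..b} u"
    unfolding u_def P_def using \<theta> by (intro continuous_intros) auto
  have "u \<theta>B = 0" using P0 by (simp add: u_def)
  moreover have "u b > 2"
    using M[of "2 * M + 7"] b \<theta> by (simp add: u_def field_simps)
  \<comment> \<open>\<open>3 / 2\<close> is the midpoint of the admissible range from 1 to 2, so by
    continuity a whole interval around \<open>c\<close> is admissible.\<close>
  ultimately obtain c where c: "\<theta>B \<le> c" "c \<le> b" "u c = 3 / 2"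
    using IVT'[of u \<theta>B "3 / 2" b] cont b by auto
  have "\<theta>B < c" "c < b" using c \<open>u \<theta>B = 0\<close> \<open>u b > 2\<close> by (auto simp: less_le)
  have "isCont u c"
    unfolding u_def P_def using \<theta> c by (intro continuous_intros) auto
  then obtain d where d: "d > 0" "\<And>x. x \<noteq> c \<Longrightarrow> dist x c < d \<Longrightarrow> dist (u x) (u c) < 1 / 2"
    using metric_LIM_D[of u "u c" c "1 / 2"] by (auto simp: isCont_def)
  define e where "e = min (d / 2) (min ((b - c) / 2) ((c - \<theta>B) / 2))"
  have e: "e > 0" "e < d" "c + e < b" "\<theta>B < c - e"
    using d(1) \<open>\<theta>B < c\<close> \<open>c < b\<close> by (auto simp: e_def min_def field_simps)
  have "\<exists>C. perm_class C \<and> growth_rate C \<gamma>" if \<gamma>: "\<gamma> \<in> {c - e..c + e}" for \<gamma>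
  proof -
    have \<gamma>': "\<gamma> \<in> {\<theta>B..b}" "dist \<gamma> c < d" using \<gamma> e by (auto simp: dist_real_def)
    then have "dist (u \<gamma>) (u c) < 1 / 2" using d(2)[of \<gamma>] by (cases "\<gamma> = c") auto
    then have "1 \<le> u \<gamma>" "u \<gamma> \<le> 2" unfolding c(3) dist_real_def abs_less_iff by linarith+
    moreover have "(1 + 1 / \<gamma>) * P (1 / \<gamma>) = u \<gamma> * (1 / \<gamma>) ^ (2 * M + 7)"
      using \<gamma>' \<theta> by (simp add: u_def)
    ultimately show ?thesis
      using growth_rate_caterpillars[of \<gamma> "u \<gamma>" M] \<gamma>' \<theta> b unfolding P_def by auto
  qed
  moreover have "\<theta>B + (c - e - \<theta>B) = c - e" "\<theta>B + (c + e - \<theta>B) = c + e" by simp_all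
  moreover have "0 < c - e - \<theta>B" "c - e - \<theta>B < c + e - \<theta>B" "c + e - \<theta>B < \<epsilon>" using e b by simp_all
  ultimately show "\<exists>\<delta>1 \<delta>2. 0 < \<delta>1 \<and> \<delta>1 < \<delta>2 \<and> \<delta>2 < \<epsilon> \<and>
           (\<forall>\<gamma>\<in>{\<theta>B + \<delta>1 .. \<theta>B + \<delta>2}. \<exists>C. perm_class C \<and> growth_rate C \<gamma>)"
    by metis
qed

end
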